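(* Fix integers $d\ge2$, $r\ge1$ and a constant $M>0$. There is a constant $C>0$ depending only on $d,r,M$ such that the following holds for all $n$. Let $H$ be a Hermitian operator on $(\mathbb C^d)^{\otimes n}$ that is translation-invariant ($H\mathcal T=\mathcal T H$) and whose spectrum has non-degenerate gaps. Let $A,B$ be traceless operators (not necessarily Hermitian or unitary), each $r$-local, with $\|A\|,\|B\|\le M$. Then $$\big|\mathrm{OTOC}^\infty(A,B)\big|\le C/n,\qquad \mathrm{OTOC}^\infty(A,B):=\lim_{\tau\to\infty}\frac1\tau\int_0^\tau\langle A^\dagger(t)B^\dagger A(t)B\rangle\,dt,$$ where $A(t):=e^{iHt}Ae^{-iHt}$ and $\langle X\rangle:=\operatorname{tr}X/D$ with $D=d^n$.
   Context: $\mathcal T$ is the unitary lattice translation operator on $(\mathbb C^d)^{\otimes n}$, defined on computational basis states by $\mathcal T(|x_1\rangle\otimes\cdots\otimes|x_n\rangle)=|x_n\rangle\otimes|x_1\rangle\otimes\cdots\otimes|x_{n-1}\rangle$. An operator is $r$-local if it acts nontrivially only on a set of at most $r$ consecutive sites (consecutive in the cyclic sense, sites $1,\dots,n$ arranged on a ring). The spectrum $\{E_j\}$ of a Hamiltonian has non-degenerate gaps if for all $j\neq k$, $E_j-E_k=E_{j'}-E_{k'}$ implies $j=j'$ and $k=k'$. $\|\cdot\|$ is the operator norm. *)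

theory Defs
  imports "HOL-Analysis.Analysis" "Jordan_Normal_Form.Jordan_Normal_Form" "Jordan_Normal_Form.Schur_Decomposition"
begin

text \<open>Basis of (C^d)^{tensor n}: index i < d^n encodes the configuration whose
  site k (k = 0..n-1) carries the digit below.\<close>
definition digit :: "nat \<Rightarrow> nat \<Rightarrow> nat \<Rightarrow> nat" where
  "digit d i k = i div d ^ k mod d"

text \<open>Lattice translation: T |x_0 ... x_{n-1}> = |x_{n-1} x_0 ... x_{n-2}>.\<close>
definition transl :: "nat \<Rightarrow> nat \<Rightarrow> complex mat" where
  "transl d n = mat (d ^ n) (d ^ n)
     (\<lambda>(i, j). if (\<forall>k<n. digit d i k = digit d j ((k + n - 1) mod n)) then 1 else 0)"

definition cyc_interval :: "nat \<Rightarrow> nat \<Rightarrow> nat \<Rightarrow> nat set" where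
  "cyc_interval n s m = {(s + j) mod n | j. j < m}"

text \<open>A is r-local: A = a_S tensor identity for a set S of at most r consecutive sites.\<close>
definition r_local :: "nat \<Rightarrow> nat \<Rightarrow> nat \<Rightarrow> complex mat \<Rightarrow> bool" where
  "r_local d n r A \<longleftrightarrow> A \<in> carrier_mat (d ^ n) (d ^ n) \<and>
     (\<exists>s m (a :: (nat \<Rightarrow> nat) \<Rightarrow> (nat \<Rightarrow> nat) \<Rightarrow> complex). m \<le> r \<and>
        (let S = cyc_interval n s m in
         \<forall>i < d ^ n. \<forall>j < d ^ n.
           A $$ (i, j) =
             (if (\<forall>k<n. k \<notin> S \<longrightarrow> digit d i k = digit d j k)
              then a (\<lambda>k. if k \<in> S then digit d i k else 0)
                     (\<lambda>k. if k \<in> S then digit d j k else 0)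
              else 0)))"

definition mtrace :: "complex mat \<Rightarrow> complex" where
  "mtrace A = (\<Sum>i<dim_row A. A $$ (i, i))"

definition mexp :: "complex mat \<Rightarrow> complex mat" where
  "mexp A = mat (dim_row A) (dim_col A)
     (\<lambda>(i, j). \<Sum>k. (A ^\<^sub>m k) $$ (i, j) / of_nat (fact k))"

definition vnorm :: "complex vec \<Rightarrow> real" where
  "vnorm v = sqrt (\<Sum>i<dim_vec v. (cmod (v $ i))\<^sup>2)"

definition opnorm :: "complex mat \<Rightarrow> real" where
  "opnorm A = Sup {vnorm (A *\<^sub>v v) | v. v \<in> carrier_vec (dim_col A) \<and> vnorm v \<le> 1}"

definition nondeg_gaps :: "complex mat \<Rightarrow> bool" where
  "nondeg_gaps H \<longleftrightarrow> (\<exists>E :: complex list. length E = dim_row H \<and>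
     char_poly H = (\<Prod>e\<leftarrow>E. [:- e, 1:]) \<and>
     (\<forall>j<length E. \<forall>k<length E. \<forall>j'<length E. \<forall>k'<length E.
        j \<noteq> k \<longrightarrow> E ! j - E ! k = E ! j' - E ! k' \<longrightarrow> j = j' \<and> k = k'))"

definition heis :: "complex mat \<Rightarrow> real \<Rightarrow> complex mat \<Rightarrow> complex mat" where
  "heis H t A = mexp ((\<i> * complex_of_real t) \<cdot>\<^sub>m H) * A * mexp ((- \<i> * complex_of_real t) \<cdot>\<^sub>m H)"

definition otoc :: "complex mat \<Rightarrow> complex mat \<Rightarrow> complex mat \<Rightarrow> real \<Rightarrow> complex" where
  "otoc H A B t = mtrace (mat_adjoint (heis H t A) * mat_adjoint B * heis H t A * B)
                   / of_nat (dim_row H)"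

end

theory Submission
  imports Defs
begin

text \<open>Write \<open>A\<^sub>j\<^sub>k\<close> and \<open>B\<^sub>j\<^sub>k\<close> for the matrix entries in an orthonormal eigenbasis of \<open>H\<close>, which is unique up
  to phases because non-degenerate gaps force a simple spectrum. In the time average only the
  resonant terms survive, i.e. those with \<open>E\<^sub>j - E\<^sub>k = E\<^sub>m - E\<^sub>l\<close>, so that \<open>j = k\<close>, \<open>m = l\<close> or
  \<open>j = m\<close>, \<open>k = l\<close>. Rows and columns of \<open>A\<close> and \<open>B\<close> have norm at most \<open>M\<close>, and the Schur test bounds
  the average by \<open>M\<^sup>2 / D\<close> times \<open>\<Sum>\<^sub>j \<bar>A\<^sub>j\<^sub>j\<bar>\<^sup>2 + \<Sum>\<^sub>j \<bar>B\<^sub>j\<^sub>j\<bar>\<^sup>2\<close>. Eigenvectors of \<open>H\<close> are eigenvectors of the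
  translation, hence \<open>A\<close> may be replaced by the mean of its \<open>n\<close> translates without changing its
  diagonal. Translates of a traceless local operator with disjoint supports are orthogonal in the
  Hilbert-Schmidt inner product, and at most \<open>n r\<^sup>2\<close> pairs of translates overlap, so the diagonal
  has total weight at most \<open>D r\<^sup>2 M\<^sup>2 / n\<close>.\<close>

section \<open>Digits, translation and supports\<close>

lemma digit_0: "digit d i 0 = i mod d"
  by (simp add: digit_def)

lemma digit_Suc: "digit d i (Suc k) = digit d (i div d) k"
  by (simp add: digit_def div_mult2_eq)

lemma digit_less: "d > 0 \<Longrightarrow> digit d i k < d"
  by (simp add: digit_def)

lemma digits_eqI:
  assumes "i < d ^ n" "j < d ^ n" "\<And>k. k < n \<Longrightarrow> digit d i k = digit d j k"
  shows "i = j"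
  using assms
proof (induction n arbitrary: i j)
  case (Suc n)
  have "i mod d = j mod d"
    using Suc.prems(3)[of 0] by (simp add: digit_0)
  moreover have "i div d = j div d"
  proof (rule Suc.IH)
    show "i div d < d ^ n" "j div d < d ^ n"
      using Suc.prems(1,2) by (simp_all add: less_mult_imp_div_less mult.commute)
    show "digit d (i div d) k = digit d (j div d) k" if "k < n" for k
      using Suc.prems(3)[of "Suc k"] that by (simp add: digit_Suc)
  qed
  ultimately show ?case by (metis mult_div_mod_eq)
qed simp

lemma ex_digits:
  assumes "\<And>k. k < n \<Longrightarrow> f k < d"
  shows "\<exists>i < d ^ n. \<forall>k<n. digit d i k = f k"
  using assms
proof (induction n arbitrary: f)
  case (Suc n)
  obtain i where i: "i < d ^ n" "\<forall>k<n. digit d i k = f (Suc k)"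
    using Suc.IH[of "\<lambda>k. f (Suc k)"] Suc.prems by auto
  have f0: "f 0 < d" using Suc.prems by simp
  have "f 0 + d * i < d * Suc i" using f0 by simp
  also have "\<dots> \<le> d ^ Suc n" using i(1) by (metis Suc_leI mult_le_mono2 power_Suc)
  finally have "f 0 + d * i < d ^ Suc n" .
  moreover have "digit d (f 0 + d * i) k = f k" if "k < Suc n" for k
    using that f0 i(2) by (cases k) (simp_all add: digit_0 digit_Suc)
  ultimately show ?case by blast
qed simp

section \<open>Translation as a permutation of basis indices\<close>

text \<open>The index of the image of basis vector \<open>j\<close> under translation, so that
  \<open>transl\<close> is the permutation matrix of \<open>shift\<close>. For positive
  \<open>d\<close> the digits prescribed below \<open>n\<close> single out exactly one
  index.\<close>

definition shift :: "nat \<Rightarrow> nat \<Rightarrow> nat \<Rightarrow> nat" where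
  "shift d n j = (THE i. i < d ^ n \<and> (\<forall>k<n. digit d i k = digit d j ((k + n - 1) mod n)))"

lemma shift:
  assumes "d > 0"
  shows "shift d n j < d ^ n"
    and "k < n \<Longrightarrow> digit d (shift d n j) k = digit d j ((k + n - 1) mod n)"
proof -
  obtain i where i: "i < d ^ n \<and> (\<forall>k<n. digit d i k = digit d j ((k + n - 1) mod n))"
    using ex_digits[of n "\<lambda>k. digit d j ((k + n - 1) mod n)" d] digit_less[OF assms] by blast
  hence "\<exists>!i. i < d ^ n \<and> (\<forall>k<n. digit d i k = digit d j ((k + n - 1) mod n))"
    by (intro ex1I[of _ i]) (auto intro: digits_eqI)
  from theI'[OF this] show "shift d n j < d ^ n"
    and "k < n \<Longrightarrow> digit d (shift d n j) k = digit d j ((k + n - 1) mod n)"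
    unfolding shift_def by auto
qed

text \<open>Forward form of the digit rule: reading \<open>Suc x mod n\<close> instead of
  \<open>(k + n - 1) mod n\<close> avoids subtraction and iterates well.\<close>

lemma digit_shift:
  assumes "d > 0" "x < n"
  shows "digit d (shift d n j) (Suc x mod n) = digit d j x"
proof -
  have "(Suc x mod n + n - 1) mod n = x"
    using assms(2) by (cases "Suc x = n") (auto simp: mod_if)
  thus ?thesis using shift(2)[OF assms(1), of "Suc x mod n" n j] assms(2) by simp
qed

lemma shift_inj:
  assumes "d > 0" "i < d ^ n" "j < d ^ n" "shift d n i = shift d n j"
  shows "i = j"
proof (rule digits_eqI[OF assms(2,3)])
  show "digit d i k = digit d j k" if "k < n" for k
    using digit_shift[OF assms(1) that, of i] digit_shift[OF assms(1) that, of j] assms(4) by simp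
qed

lemma shift_bij:
  assumes "d > 0"
  shows "bij_betw (shift d n) {..<d ^ n} {..<d ^ n}"
proof -
  have inj: "inj_on (shift d n) {..<d ^ n}"
    using shift_inj[OF assms] by (auto intro: inj_onI)
  have "shift d n ` {..<d ^ n} \<subseteq> {..<d ^ n}" using shift(1)[OF assms] by auto
  with inj show ?thesis
    by (metis bij_betw_def endo_inj_surj finite_lessThan)
qed

lemma transl_index:
  assumes "d > 0" "i < d ^ n" "j < d ^ n"
  shows "transl d n $$ (i, j) = (if i = shift d n j then 1 else 0)"
proof -
  have "(\<forall>k<n. digit d i k = digit d j ((k + n - 1) mod n)) \<longleftrightarrow> i = shift d n j"
    using shift[OF assms(1)] by (auto intro: digits_eqI[OF assms(2)])
  thus ?thesis using assms by (simp add: transl_def)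
qed

lemma shift_funpow_less: "d > 0 \<Longrightarrow> i < d ^ n \<Longrightarrow> (shift d n ^^ k) i < d ^ n"
  by (cases k) (simp_all add: shift(1))

lemma digit_shift_funpow:
  assumes "d > 0" "x < n"
  shows "digit d ((shift d n ^^ k) i) ((x + k) mod n) = digit d i x"
proof (induction k)
  case (Suc k)
  have "(x + Suc k) mod n = Suc ((x + k) mod n) mod n" by (simp add: mod_Suc_eq)
  moreover have "(x + k) mod n < n" using assms by simp
  ultimately show ?case using digit_shift[OF assms(1)] Suc by simp
qed (use assms in simp)

section \<open>Operators supported on a set of sites\<close>

text \<open>Keeps just two consequences of locality: an entry vanishes if the configurations differ
  outside \<open>S\<close>, and a diagonal entry depends only on the digits in \<open>S\<close>.
  Both pass to translates without following the kernel of the local factor.\<close>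

definition supported :: "nat \<Rightarrow> nat \<Rightarrow> nat set \<Rightarrow> complex mat \<Rightarrow> bool" where
  "supported d n S A \<longleftrightarrow> A \<in> carrier_mat (d ^ n) (d ^ n) \<and> S \<subseteq> {..<n} \<and>
     (\<forall>i<d ^ n. \<forall>j<d ^ n. (\<exists>k<n. k \<notin> S \<and> digit d i k \<noteq> digit d j k) \<longrightarrow> A $$ (i, j) = 0) \<and>
     (\<forall>i<d ^ n. \<forall>j<d ^ n. (\<forall>k\<in>S. digit d i k = digit d j k) \<longrightarrow> A $$ (i, i) = A $$ (j, j))"

lemma supported_carrier: "supported d n S A \<Longrightarrow> A \<in> carrier_mat (d ^ n) (d ^ n)"
  unfolding supported_def by blast

lemma supported_subset: "supported d n S A \<Longrightarrow> S \<subseteq> {..<n}"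
  unfolding supported_def by blast

lemma supported_off_diag:
  assumes "supported d n S A" "i < d ^ n" "j < d ^ n" "k < n" "k \<notin> S" "digit d i k \<noteq> digit d j k"
  shows "A $$ (i, j) = 0"
  using assms unfolding supported_def by blast

lemma supported_diag:
  assumes "supported d n S A" "i < d ^ n" "j < d ^ n" "\<And>k. k \<in> S \<Longrightarrow> digit d i k = digit d j k"
  shows "A $$ (i, i) = A $$ (j, j)"
  using assms unfolding supported_def by blast

text \<open>Positivity of \<open>n\<close> places the interval inside \<open>{..<n}\<close>;
  reduction modulo zero would leave its points where they are.\<close>

lemma r_local_supported:
  assumes "r_local d n r A" "n > 0"
  obtains s m where "m \<le> r" "supported d n (cyc_interval n s m) A"
proof -
  obtain s m a where m: "m \<le> r" and A: "A \<in> carrier_mat (d ^ n) (d ^ n)"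
    and a: "\<forall>i < d ^ n. \<forall>j < d ^ n. A $$ (i, j) =
             (if (\<forall>k<n. k \<notin> cyc_interval n s m \<longrightarrow> digit d i k = digit d j k)
              then a (\<lambda>k. if k \<in> cyc_interval n s m then digit d i k else 0)
                     (\<lambda>k. if k \<in> cyc_interval n s m then digit d j k else 0)
              else 0)"
    using assms(1) unfolding r_local_def Let_def by blast
  let ?S = "cyc_interval n s m"
  have "A $$ (i, i) = A $$ (j, j)"
    if "i < d ^ n" "j < d ^ n" "\<forall>k\<in>?S. digit d i k = digit d j k" for i j
  proof -
    \<comment> \<open>The kernel \<open>a\<close> sees configurations zeroed outside the interval,
      so agreement on the interval makes its arguments equal as functions.\<close>
    have "(\<lambda>k. if k \<in> ?S then digit d i k else 0) = (\<lambda>k. if k \<in> ?S then digit d j k else 0)"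
      using that(3) by auto
    thus ?thesis using a that(1,2) by simp
  qed
  moreover have "A $$ (i, j) = 0"
    if "i < d ^ n" "j < d ^ n" "\<exists>k<n. k \<notin> ?S \<and> digit d i k \<noteq> digit d j k" for i j
  proof -
    have "(\<forall>k<n. k \<notin> ?S \<longrightarrow> digit d i k = digit d j k) = False" using that(3) by blast
    thus ?thesis by (simp only: a[rule_format, OF that(1,2)] if_False)
  qed
  moreover have "?S \<subseteq> {..<n}" using assms(2) by (auto simp: cyc_interval_def)
  ultimately have "supported d n ?S A"
    unfolding supported_def using A by blast
  with m that show ?thesis by blast
qed

text \<open>Exchanging the digits in \<open>S\<close> of the two indices turns the double sum into one over a single
  index, because \<open>f\<close> and \<open>g\<close> then read the same index.\<close>

lemma sum_indep_digits:
  fixes f g :: "nat \<Rightarrow> complex"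
  assumes d: "d > 0" and "S \<inter> S' = {}" "S \<subseteq> {..<n}" "S' \<subseteq> {..<n}"
    and f: "\<And>i j. i < d ^ n \<Longrightarrow> j < d ^ n \<Longrightarrow> (\<And>k. k \<in> S \<Longrightarrow> digit d i k = digit d j k) \<Longrightarrow> f i = f j"
    and g: "\<And>i j. i < d ^ n \<Longrightarrow> j < d ^ n \<Longrightarrow> (\<And>k. k \<in> S' \<Longrightarrow> digit d i k = digit d j k) \<Longrightarrow> g i = g j"
  shows "(\<Sum>i<d ^ n. f i) * (\<Sum>i<d ^ n. g i) = of_nat (d ^ n) * (\<Sum>i<d ^ n. f i * g i)"
proof -
  have "\<exists>p<d ^ n. \<forall>k<n. digit d p k = (if k \<in> S then digit d i k else digit d j k)" for i j
    by (rule ex_digits) (simp add: digit_less[OF d])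
  then obtain mix where mix: "\<And>i j. mix i j < d ^ n"
    and dm: "\<And>i j k. k < n \<Longrightarrow> digit d (mix i j) k = (if k \<in> S then digit d i k else digit d j k)"
    by metis
  have S': "k < n \<and> k \<notin> S" if "k \<in> S'" for k
    using that assms(2,4) by auto
  define sw where "sw = (\<lambda>(i, j). (mix i j, mix j i))"
  have inv: "sw (sw (i, j)) = (i, j)" if "i < d ^ n" "j < d ^ n" for i j
  proof -
    have "mix (mix i j) (mix j i) = i" "mix (mix j i) (mix i j) = j"
      by (rule digits_eqI[where n = n], use that mix in \<open>auto simp: dm\<close>)+
    thus ?thesis by (simp add: sw_def)
  qed
  have "(\<Sum>i<d ^ n. f i) * (\<Sum>i<d ^ n. g i) = (\<Sum>(i, j)\<in>{..<d ^ n} \<times> {..<d ^ n}. f i * g j)"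
    by (simp add: sum_product sum.cartesian_product)
  also have "\<dots> = (\<Sum>(i, j)\<in>{..<d ^ n} \<times> {..<d ^ n}. f i * g i)"
  proof (rule sum.reindex_bij_witness[where i = sw and j = sw])
    fix p assume p: "p \<in> {..<d ^ n} \<times> {..<d ^ n}"
    then obtain i j where ij: "p = (i, j)" "i < d ^ n" "j < d ^ n" by auto
    show "sw (sw p) = p" using inv ij by simp
    show "sw p \<in> {..<d ^ n} \<times> {..<d ^ n}" using ij mix by (simp add: sw_def)
    have "f (mix i j) = f i" by (rule f) (use ij mix assms(3) in \<open>auto simp: dm\<close>)
    moreover have "g (mix i j) = g j" by (rule g) (use ij mix S' in \<open>simp_all add: dm\<close>)
    ultimately show "(case sw p of (i, j) \<Rightarrow> f i * g i) = (case p of (i, j) \<Rightarrow> f i * g j)"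
      by (simp add: ij sw_def)
  qed (use inv mix in \<open>auto simp: sw_def\<close>)
  also have "\<dots> = of_nat (d ^ n) * (\<Sum>i<d ^ n. f i * g i)"
    by (simp add: sum.cartesian_product[symmetric] sum_distrib_left)
  finally show ?thesis .
qed

text \<open>A site where \<open>i\<close> and \<open>j\<close> differ lies outside at least one of
  the disjoint supports, so only diagonal terms survive. The two diagonals depend on disjoint sets
  of digits, so up to the factor \<open>d ^ n\<close> their sum of products is the product of a
  conjugated trace of \<open>X\<close> and the trace of \<open>Y\<close>, and the latter is
  zero.\<close>

lemma supported_disjoint_orthogonal:
  assumes d: "d > 0" and X: "supported d n S X" and Y: "supported d n S' Y" and "S \<inter> S' = {}"
    and "mtrace Y = 0"
  shows "(\<Sum>i<d ^ n. \<Sum>j<d ^ n. cnj (X $$ (i, j)) * Y $$ (i, j)) = 0"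
proof -
  have entry: "cnj (X $$ (i, j)) * Y $$ (i, j) = (if i = j then cnj (X $$ (i, i)) * Y $$ (i, i) else 0)"
    if ij: "i < d ^ n" "j < d ^ n" for i j
  proof (cases "i = j")
    case False
    then obtain k where "k < n" "digit d i k \<noteq> digit d j k"
      using digits_eqI[OF ij] by blast
    moreover have "k \<notin> S \<or> k \<notin> S'" using assms(4) by blast
    ultimately have "X $$ (i, j) = 0 \<or> Y $$ (i, j) = 0"
      using supported_off_diag[OF X ij] supported_off_diag[OF Y ij] by metis
    thus ?thesis using False by auto
  qed simp
  have "(\<Sum>i<d ^ n. \<Sum>j<d ^ n. cnj (X $$ (i, j)) * Y $$ (i, j)) =
      (\<Sum>i<d ^ n. \<Sum>j<d ^ n. if i = j then cnj (X $$ (i, i)) * Y $$ (i, i) else 0)"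
    by (intro sum.cong refl, rule entry) auto
  hence "(\<Sum>i<d ^ n. \<Sum>j<d ^ n. cnj (X $$ (i, j)) * Y $$ (i, j)) =
      (\<Sum>i<d ^ n. cnj (X $$ (i, i)) * Y $$ (i, i))"
    by simp
  moreover have "(\<Sum>i<d ^ n. cnj (X $$ (i, i))) * (\<Sum>i<d ^ n. Y $$ (i, i)) =
      of_nat (d ^ n) * (\<Sum>i<d ^ n. cnj (X $$ (i, i)) * Y $$ (i, i))"
  proof (rule sum_indep_digits[OF d assms(4)])
    show "S \<subseteq> {..<n}" "S' \<subseteq> {..<n}" by (rule supported_subset[OF X], rule supported_subset[OF Y])
    show "cnj (X $$ (i, i)) = cnj (X $$ (j, j))" if "i < d ^ n" "j < d ^ n"
      "\<And>k. k \<in> S \<Longrightarrow> digit d i k = digit d j k" for i j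
      using supported_diag[OF X that] by simp
    show "Y $$ (i, i) = Y $$ (j, j)" if "i < d ^ n" "j < d ^ n"
      "\<And>k. k \<in> S' \<Longrightarrow> digit d i k = digit d j k" for i j
      using supported_diag[OF Y that] .
  qed
  moreover have "(\<Sum>i<d ^ n. Y $$ (i, i)) = 0"
    using assms(5) supported_carrier[OF Y] by (simp add: mtrace_def)
  ultimately show ?thesis using d by simp
qed

section \<open>Translates of local operators and their overlaps\<close>

text \<open>Conjugation T^(-k) A T^k by the translation T, written as a relabelling of indices. In
  this form traces, Frobenius norms and supports can be read off directly.\<close>

definition translate :: "nat \<Rightarrow> nat \<Rightarrow> nat \<Rightarrow> complex mat \<Rightarrow> complex mat" where
  "translate d n k A =
     mat (d ^ n) (d ^ n) (\<lambda>(i, j). A $$ ((shift d n ^^ k) i, (shift d n ^^ k) j))"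

lemma translate_carrier [simp]: "translate d n k A \<in> carrier_mat (d ^ n) (d ^ n)"
  by (simp add: translate_def)

lemma sum_shift_funpow:
  assumes "d > 0"
  shows "(\<Sum>i<d ^ n. f ((shift d n ^^ k) i)) = (\<Sum>i<d ^ n. f i)"
proof -
  have "bij_betw (shift d n ^^ k) {..<d ^ n} {..<d ^ n}"
    by (rule bij_betw_funpow[OF shift_bij[OF assms]])
  thus ?thesis by (rule sum.reindex_bij_betw)
qed

lemma mtrace_translate:
  assumes "d > 0" "A \<in> carrier_mat (d ^ n) (d ^ n)"
  shows "mtrace (translate d n k A) = mtrace A"
  using sum_shift_funpow[OF assms(1), of "\<lambda>i. A $$ (i, i)" k n] assms(2)
  by (simp add: mtrace_def translate_def)

text \<open>Site \<open>x\<close> of an index becomes site \<open>x + k\<close> of the relabelled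
  index, so the support is the preimage of \<open>S\<close> under the rotation by
  \<open>k\<close>.\<close>

lemma supported_translate:
  assumes d: "d > 0" and A: "supported d n S A"
  shows "supported d n {x. x < n \<and> (x + k) mod n \<in> S} (translate d n k A)"
proof -
  let ?p = "shift d n ^^ k"
  let ?S = "{x. x < n \<and> (x + k) mod n \<in> S}"
  have off: "translate d n k A $$ (i, j) = 0"
    if ij: "i < d ^ n" "j < d ^ n" and "\<exists>x<n. x \<notin> ?S \<and> digit d i x \<noteq> digit d j x" for i j
  proof -
    note pij = shift_funpow_less[OF d ij(1), of k] shift_funpow_less[OF d ij(2), of k]
    from that(3) obtain x where x: "x < n" "(x + k) mod n \<notin> S" "digit d i x \<noteq> digit d j x" by auto
    have "digit d (?p i) ((x + k) mod n) \<noteq> digit d (?p j) ((x + k) mod n)"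
      using x by (simp add: digit_shift_funpow[OF d])
    moreover have "(x + k) mod n < n" using x by simp
    ultimately have "A $$ (?p i, ?p j) = 0"
      using supported_off_diag[OF A pij _ x(2)] by blast
    thus ?thesis using ij by (simp add: translate_def)
  qed
  have diag: "translate d n k A $$ (i, i) = translate d n k A $$ (j, j)"
    if ij: "i < d ^ n" "j < d ^ n" and *: "\<forall>x\<in>?S. digit d i x = digit d j x" for i j
  proof -
    note pij = shift_funpow_less[OF d ij(1), of k] shift_funpow_less[OF d ij(2), of k]
    have "digit d (?p i) y = digit d (?p j) y" if "y \<in> S" for y
    proof -
      have y: "y < n" using supported_subset[OF A] that by auto
      \<comment> \<open>This is \<open>y - k\<close> modulo \<open>n\<close>; reducing
        \<open>k\<close> first keeps the subtraction on naturals from truncating.\<close>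
      define x where "x = (y + (n - k mod n)) mod n"
      have "(x + k) mod n = (y + (n - k mod n) + k mod n) mod n"
        unfolding x_def by (metis mod_add_left_eq mod_add_right_eq)
      also have "y + (n - k mod n) + k mod n = y + n"
        using mod_less_divisor[of n k] y by linarith
      finally have xk: "(x + k) mod n = y" using y by simp
      have "x < n" using y by (simp add: x_def)
      with * xk that digit_shift_funpow[OF d this, of k] show ?thesis by (metis mem_Collect_eq)
    qed
    hence "A $$ (?p i, ?p i) = A $$ (?p j, ?p j)"
      by (rule supported_diag[OF A pij])
    thus ?thesis using ij by (simp add: translate_def)
  qed
  have sub: "?S \<subseteq> {..<n}" by auto
  show ?thesis
    unfolding supported_def
    by (intro conjI allI impI; (rule translate_carrier sub | (rule off diag; assumption)))
qed

text \<open>A common site \<open>x\<close> at offsets \<open>j\<close> and \<open>j'\<close> in the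
  interval gives x + k = s + j and x + k' = s + j' modulo \<open>n\<close>, hence k' = k + j' - j.
  An overlapping pair is thus determined by \<open>k\<close> and two offsets below
  \<open>r\<close>.\<close>

lemma card_overlapping_translates:
  assumes "n > 0" "m \<le> r"
  shows "card {(k, k'). k < n \<and> k' < n \<and>
      {x. x < n \<and> (x + k) mod n \<in> cyc_interval n s m} \<inter>
      {x. x < n \<and> (x + k') mod n \<in> cyc_interval n s m} \<noteq> {}} \<le> n * r\<^sup>2"
proof -
  let ?P = "{..<n} \<times> {..<r} \<times> {..<r}"
  \<comment> \<open>The computation runs in the integers because \<open>j\<close> may exceed
    \<open>k + j'\<close>; the residue is nonnegative, so \<open>nat\<close> loses nothing.\<close>
  let ?h = "\<lambda>(k, j, j'). (k, nat ((int k + int j' - int j) mod int n))"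
  have "{(k, k'). k < n \<and> k' < n \<and>
      {x. x < n \<and> (x + k) mod n \<in> cyc_interval n s m} \<inter>
      {x. x < n \<and> (x + k') mod n \<in> cyc_interval n s m} \<noteq> {}} \<subseteq> ?h ` ?P"
  proof
    fix p assume "p \<in> {(k, k'). k < n \<and> k' < n \<and>
      {x. x < n \<and> (x + k) mod n \<in> cyc_interval n s m} \<inter>
      {x. x < n \<and> (x + k') mod n \<in> cyc_interval n s m} \<noteq> {}}"
    then obtain k k' x where p: "p = (k, k')" and k: "k < n" "k' < n"
      and "(x + k) mod n \<in> cyc_interval n s m" "(x + k') mod n \<in> cyc_interval n s m"
      by auto
    then obtain j j' where j: "j < m" "j' < m" "(x + k) mod n = (s + j) mod n"
      "(x + k') mod n = (s + j') mod n" by (auto simp: cyc_interval_def)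
    have "(int x + int k) mod int n = (int s + int j) mod int n"
      "(int x + int k') mod int n = (int s + int j') mod int n"
      using j(3,4) by (metis of_nat_add of_nat_mod)+
    hence "int n dvd (int x + int k) - (int s + int j)"
      "int n dvd (int x + int k') - (int s + int j')"
      by (simp_all add: mod_eq_dvd_iff)
    \<comment> \<open>Subtracting the two congruences eliminates both \<open>x\<close> and
      \<open>s\<close>.\<close>
    from dvd_diff[OF this] have "int n dvd (int k + int j' - int j) - int k'"
      by (simp add: algebra_simps)
    hence "(int k + int j' - int j) mod int n = int k'"
      using k(2) by (simp add: mod_eq_dvd_iff[symmetric])
    hence "(k, k') = ?h (k, j, j')" by simp
    moreover have "(k, j, j') \<in> ?P" using k j(1,2) assms(2) by simp
    ultimately show "p \<in> ?h ` ?P" unfolding p by (rule image_eqI)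
  qed
  hence "card {(k, k'). k < n \<and> k' < n \<and>
      {x. x < n \<and> (x + k) mod n \<in> cyc_interval n s m} \<inter>
      {x. x < n \<and> (x + k') mod n \<in> cyc_interval n s m} \<noteq> {}} \<le> card (?h ` ?P)"
    by (intro card_mono) auto
  also have "\<dots> \<le> card ?P" by (rule card_image_le) simp
  also have "\<dots> = n * r\<^sup>2" by (simp add: power2_eq_square)
  finally show ?thesis .
qed

section \<open>Unitary changes of basis and operator bounds\<close>

lemma mat_mult_index:
  assumes "A \<in> carrier_mat n m" "B \<in> carrier_mat m p" "i < n" "j < p"
  shows "(A * B) $$ (i, j) = (\<Sum>k<m. A $$ (i, k) * B $$ (k, j))"
  using assms by (simp add: scalar_prod_def atLeast0LessThan)

lemma mat_adjoint_index:
  "i < dim_col A \<Longrightarrow> j < dim_row A \<Longrightarrow> mat_adjoint A $$ (i, j) = cnj (A $$ (j, i))"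
  by (simp add: mat_adjoint_def mat_of_rows_index)

lemma mat_adjoint_carrier [simp]:
  "A \<in> carrier_mat n m \<Longrightarrow> mat_adjoint A \<in> carrier_mat m n"
  by (auto simp: mat_adjoint_def)

lemma mat_adjoint_dim [simp]:
  "dim_row (mat_adjoint A) = dim_col A" "dim_col (mat_adjoint A) = dim_row A"
  by (auto simp: mat_adjoint_def)

lemma mat_adjoint_adjoint [simp]: "mat_adjoint (mat_adjoint A) = (A :: complex mat)"
  by (rule eq_matI) (simp_all add: mat_adjoint_index)

lemma mat_adjoint_mult:
  fixes A B :: "complex mat"
  assumes "A \<in> carrier_mat n m" "B \<in> carrier_mat m p"
  shows "mat_adjoint (A * B) = mat_adjoint B * mat_adjoint A"
proof (rule eq_matI)
  fix i j assume "i < dim_row (mat_adjoint B * mat_adjoint A)" "j < dim_col (mat_adjoint B * mat_adjoint A)"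
  hence ij: "i < p" "j < n" using assms by auto
  have "mat_adjoint (A * B) $$ (i, j) = cnj ((A * B) $$ (j, i))"
    using ij assms by (simp add: mat_adjoint_index del: index_mult_mat(1))
  also have "\<dots> = (\<Sum>k<m. cnj (B $$ (k, i)) * cnj (A $$ (j, k)))"
    using ij assms by (simp add: mat_mult_index[OF assms] mult.commute del: index_mult_mat(1))
  also have "\<dots> = (mat_adjoint B * mat_adjoint A) $$ (i, j)"
    using ij assms
    by (subst mat_mult_index[of _ p m _ n]) (auto simp: mat_adjoint_index intro!: sum.cong)
  finally show "mat_adjoint (A * B) $$ (i, j) = (mat_adjoint B * mat_adjoint A) $$ (i, j)" .
qed (use assms in auto)

lemma mtrace_mult_comm:
  assumes "A \<in> carrier_mat n m" "B \<in> carrier_mat m n"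
  shows "mtrace (A * B) = mtrace (B * A)"
proof -
  have "mtrace (A * B) = (\<Sum>i<n. \<Sum>k<m. A $$ (i, k) * B $$ (k, i))"
    using assms by (simp add: mtrace_def mat_mult_index[OF assms] del: index_mult_mat(1))
  also have "\<dots> = (\<Sum>k<m. \<Sum>i<n. B $$ (k, i) * A $$ (i, k))"
    by (subst sum.swap) (simp add: mult.commute)
  also have "\<dots> = mtrace (B * A)"
    using assms by (simp add: mtrace_def mat_mult_index[OF assms(2,1)] del: index_mult_mat(1))
  finally show ?thesis .
qed

definition frob_sq :: "complex mat \<Rightarrow> real" where
  "frob_sq A = (\<Sum>i<dim_row A. \<Sum>j<dim_col A. (cmod (A $$ (i, j)))\<^sup>2)"

lemma adjoint_mult_self_diag:
  assumes "A \<in> carrier_mat n m" "j < m"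
  shows "(mat_adjoint A * A) $$ (j, j) = complex_of_real (\<Sum>i<n. (cmod (A $$ (i, j)))\<^sup>2)"
  using assms
  by (subst mat_mult_index[of _ m n _ m])
     (auto simp: mat_adjoint_index complex_norm_square mult.commute simp del: of_real_power intro!: sum.cong)

lemma mtrace_adjoint_mult_self: "mtrace (mat_adjoint A * A) = complex_of_real (frob_sq A)"
proof -
  have "mtrace (mat_adjoint A * A)
      = (\<Sum>j<dim_col A. complex_of_real (\<Sum>i<dim_row A. (cmod (A $$ (i, j)))\<^sup>2))"
    unfolding mtrace_def
    by (intro sum.cong) (simp_all add: adjoint_mult_self_diag[of A "dim_row A" "dim_col A"] del: index_mult_mat(1))
  also have "\<dots> = complex_of_real (frob_sq A)"
    unfolding frob_sq_def by (subst sum.swap) simp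
  finally show ?thesis .
qed

section \<open>Unitary changes of basis\<close>

definition unitary :: "nat \<Rightarrow> complex mat \<Rightarrow> bool" where
  "unitary N U \<longleftrightarrow> U \<in> carrier_mat N N \<and> mat_adjoint U * U = 1\<^sub>m N \<and> U * mat_adjoint U = 1\<^sub>m N"

lemma unitaryI:
  assumes "U \<in> carrier_mat N N" "mat_adjoint U * U = 1\<^sub>m N"
  shows "unitary N U"
  using assms mat_mult_left_right_inverse[of "mat_adjoint U" N U] by (simp add: unitary_def)

lemma unitary_carrier:
  assumes "unitary N U"
  shows "U \<in> carrier_mat N N" "mat_adjoint U \<in> carrier_mat N N"
  using assms by (simp_all add: unitary_def)

lemma sq_mat_assoc:
  fixes A B C :: "complex mat"
  assumes "A \<in> carrier_mat N N" "B \<in> carrier_mat N N" "C \<in> carrier_mat N N"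
  shows "A * B * C = A * (B * C)"
  using assms by (rule assoc_mult_mat)

lemma unitary_cancel:
  assumes "unitary N U" "X \<in> carrier_mat N N"
  shows "mat_adjoint U * (U * X) = X" "U * (mat_adjoint U * X) = X"
  using assms sq_mat_assoc[of "mat_adjoint U" N U X] sq_mat_assoc[of U N "mat_adjoint U" X]
  by (simp_all add: unitary_def)

text \<open>The matrix of \<open>X\<close> in the basis formed by the columns of \<open>U\<close>.
  It serves both for passing to the eigenbasis of the Hamiltonian and for conjugating by the
  translation.\<close>

definition rebase :: "complex mat \<Rightarrow> complex mat \<Rightarrow> complex mat" where
  "rebase U X = mat_adjoint U * X * U"

lemma rebase_carrier:
  "unitary N U \<Longrightarrow> X \<in> carrier_mat N N \<Longrightarrow> rebase U X \<in> carrier_mat N N"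
  using unitary_carrier[of N U] by (simp add: rebase_def mult_carrier_mat[where nr = N and n = N and nc = N])

lemma rebase_mult:
  assumes U: "unitary N U" and X: "X \<in> carrier_mat N N" and Y: "Y \<in> carrier_mat N N"
  shows "rebase U (X * Y) = rebase U X * rebase U Y"
proof -
  note c = unitary_carrier[OF U] X Y
  show ?thesis
    unfolding rebase_def using c
    by (simp add: sq_mat_assoc[where N = N] unitary_cancel[OF U] mult_carrier_mat[where nr = N and n = N and nc = N])
qed

lemma rebase_adjoint:
  assumes U: "unitary N U" and X: "X \<in> carrier_mat N N"
  shows "rebase U (mat_adjoint X) = mat_adjoint (rebase U X)"
proof -
  note c = unitary_carrier[OF U] X
  show ?thesis
    unfolding rebase_def using c
    by (simp add: sq_mat_assoc[where N = N] mat_adjoint_mult[where n = N and m = N and p = N]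
        mult_carrier_mat[where nr = N and n = N and nc = N])
qed

lemma mtrace_rebase:
  assumes U: "unitary N U" and X: "X \<in> carrier_mat N N"
  shows "mtrace (rebase U X) = mtrace X"
proof -
  note c = unitary_carrier[OF U] X
  have "mtrace (rebase U X) = mtrace (U * (mat_adjoint U * X))"
    unfolding rebase_def using c
    by (subst mtrace_mult_comm[of _ N N]) (simp_all add: mult_carrier_mat[where nr = N and n = N and nc = N])
  thus ?thesis using unitary_cancel[OF U X] by simp
qed

text \<open>The squared Frobenius norm is the trace of \<open>mat_adjoint X * X\<close>, and unitary
  conjugation respects products, adjoints and the trace.\<close>

lemma frob_sq_rebase:
  assumes U: "unitary N U" and X: "X \<in> carrier_mat N N"
  shows "frob_sq (rebase U X) = frob_sq X"
proof -
  have "complex_of_real (frob_sq (rebase U X)) = mtrace (rebase U (mat_adjoint X * X))"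
    using X by (simp add: mtrace_adjoint_mult_self[symmetric] rebase_adjoint[OF U, symmetric]
      rebase_mult[OF U, symmetric])
  also have "\<dots> = complex_of_real (frob_sq X)"
    using X mtrace_rebase[OF U] by (simp add: mtrace_adjoint_mult_self mult_carrier_mat[where nr = N and n = N and nc = N])
  finally show ?thesis by (simp only: of_real_eq_iff)
qed

lemma rebase_inverse:
  assumes U: "unitary N U" and X: "X \<in> carrier_mat N N"
  shows "rebase U (U * X * mat_adjoint U) = X" "U * rebase U X * mat_adjoint U = X"
proof -
  note c = unitary_carrier[OF U] X
  have UU: "mat_adjoint U * U = 1\<^sub>m N" "U * mat_adjoint U = 1\<^sub>m N" using U by (simp_all add: unitary_def)
  show "rebase U (U * X * mat_adjoint U) = X" "U * rebase U X * mat_adjoint U = X"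
    unfolding rebase_def using c
    by (simp_all add: sq_mat_assoc[where N = N] unitary_cancel[OF U] UU mult_carrier_mat[where nr = N and n = N and nc = N])
qed

section \<open>Vector norms and operator bounds\<close>

lemma mult_mat_vec_index:
  assumes "A \<in> carrier_mat n m" "v \<in> carrier_vec m" "i < n"
  shows "vec_index (A *\<^sub>v v) i = (\<Sum>j<m. A $$ (i, j) * vec_index v j)"
  using assms by (simp add: scalar_prod_def atLeast0LessThan)

lemma cscalar_prod_sum:
  fixes v w :: "complex vec"
  assumes "v \<in> carrier_vec n" "w \<in> carrier_vec n"
  shows "v \<bullet>c w = (\<Sum>i<n. vec_index v i * cnj (vec_index w i))"
  using assms by (simp add: scalar_prod_def atLeast0LessThan)

lemma adjoint_cscalar_prod:
  fixes A :: "complex mat"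
  assumes A: "A \<in> carrier_mat n m" and v: "v \<in> carrier_vec m" and w: "w \<in> carrier_vec n"
  shows "(A *\<^sub>v v) \<bullet>c w = v \<bullet>c (mat_adjoint A *\<^sub>v w)"
proof -
  have "(A *\<^sub>v v) \<bullet>c w = (\<Sum>i<n. \<Sum>j<m. A $$ (i, j) * vec_index v j * cnj (vec_index w i))"
    using A v w by (subst cscalar_prod_sum[of _ n])
      (auto simp: mult_mat_vec_index[OF A v] sum_distrib_right simp del: index_mult_mat_vec intro!: sum.cong)
  also have "\<dots> = (\<Sum>j<m. \<Sum>i<n. A $$ (i, j) * vec_index v j * cnj (vec_index w i))"
    by (rule sum.swap)
  also have "\<dots> = v \<bullet>c (mat_adjoint A *\<^sub>v w)"
    using A v w by (subst cscalar_prod_sum[of _ m])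
      (auto simp: mult_mat_vec_index[of _ m n] mult_mat_vec_carrier[of _ m n] mat_adjoint_index sum_distrib_left mult_ac
        simp del: index_mult_mat_vec intro!: sum.cong)
  finally show ?thesis .
qed

lemma vnorm_L2_set: "vnorm v = L2_set (\<lambda>i. cmod (vec_index v i)) {..<dim_vec v}"
  by (simp add: vnorm_def L2_set_def)

lemma vnorm_nonneg [simp]: "vnorm v \<ge> 0"
  by (simp add: vnorm_L2_set)

lemma cscalar_prod_self: "v \<bullet>c v = complex_of_real ((vnorm v)\<^sup>2)"
proof -
  have "v \<bullet>c v = (\<Sum>i<dim_vec v. complex_of_real ((cmod (vec_index v i))\<^sup>2))"
    by (subst cscalar_prod_sum[of _ "dim_vec v"])
       (auto simp: complex_norm_square simp del: of_real_power intro!: sum.cong)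
  also have "\<dots> = complex_of_real ((vnorm v)\<^sup>2)"
    by (simp add: vnorm_def sum_nonneg)
  finally show ?thesis .
qed

lemma cscalar_prod_le_vnorm:
  assumes "v \<in> carrier_vec n" "w \<in> carrier_vec n"
  shows "cmod (v \<bullet>c w) \<le> vnorm v * vnorm w"
proof -
  have "cmod (v \<bullet>c w) \<le> (\<Sum>i<n. \<bar>cmod (vec_index v i)\<bar> * \<bar>cmod (vec_index w i)\<bar>)"
    unfolding cscalar_prod_sum[OF assms]
    by (rule order_trans[OF norm_sum]) (simp add: norm_mult)
  also have "\<dots> \<le> vnorm v * vnorm w"
    using assms L2_set_mult_ineq[of "\<lambda>i. cmod (vec_index v i)" "\<lambda>i. cmod (vec_index w i)" "{..<n}"]
    by (simp add: vnorm_L2_set)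
  finally show ?thesis .
qed

lemma vnorm_smult: "vnorm (c \<cdot>\<^sub>v v) = cmod c * vnorm v"
  by (simp add: vnorm_def norm_mult power_mult_distrib sum_distrib_left[symmetric] real_sqrt_mult)

text \<open>An upper bound on the operator norm stated vector by vector, so that no supremum has to
  be handled afterwards.\<close>

definition bounded_by :: "nat \<Rightarrow> real \<Rightarrow> complex mat \<Rightarrow> bool" where
  "bounded_by N M A \<longleftrightarrow> A \<in> carrier_mat N N \<and> (\<forall>v\<in>carrier_vec N. vnorm v \<le> 1 \<longrightarrow> vnorm (A *\<^sub>v v) \<le> M)"

text \<open>The supremum in \<open>opnorm\<close> dominates its members only if the set is bounded
  above. The sum of the moduli of all entries is a crude bound that suffices.\<close>

lemma bounded_by_opnorm:
  assumes A: "A \<in> carrier_mat N N"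
  shows "bounded_by N (opnorm A) A"
proof -
  let ?S = "{vnorm (A *\<^sub>v v) | v. v \<in> carrier_vec (dim_col A) \<and> vnorm v \<le> 1}"
  have "vnorm (A *\<^sub>v v) \<le> (\<Sum>i<N. \<Sum>j<N. cmod (A $$ (i, j)))"
    if v: "v \<in> carrier_vec N" "vnorm v \<le> 1" for v
  proof -
    have c: "cmod (vec_index v j) \<le> 1" if "j < N" for j
      using member_le_L2_set[of "{..<N}" j "\<lambda>i. cmod (vec_index v i)"] that v
      by (simp add: vnorm_L2_set)
    have "vnorm (A *\<^sub>v v) \<le> (\<Sum>i<N. cmod (vec_index (A *\<^sub>v v) i))"
      using L2_set_le_sum[of "{..<N}" "\<lambda>i. cmod (vec_index (A *\<^sub>v v) i)"] A
      by (simp add: vnorm_L2_set del: index_mult_mat_vec)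
    also have "\<dots> \<le> (\<Sum>i<N. \<Sum>j<N. cmod (A $$ (i, j)))"
    proof (rule sum_mono)
      fix i assume "i \<in> {..<N}"
      hence "cmod (vec_index (A *\<^sub>v v) i) \<le> (\<Sum>j<N. cmod (A $$ (i, j) * vec_index v j))"
        by (simp add: mult_mat_vec_index[OF A v(1)] norm_sum del: index_mult_mat_vec)
      also have "\<dots> \<le> (\<Sum>j<N. cmod (A $$ (i, j)))"
        using c by (intro sum_mono) (simp add: norm_mult mult_left_le)
      finally show "cmod (vec_index (A *\<^sub>v v) i) \<le> (\<Sum>j<N. cmod (A $$ (i, j)))" .
    qed
    finally show ?thesis .
  qed
  hence "bdd_above ?S" using A by (intro bdd_aboveI[of _ "\<Sum>i<N. \<Sum>j<N. cmod (A $$ (i, j))"]) auto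
  thus ?thesis
    unfolding bounded_by_def opnorm_def using A by (auto intro!: cSup_upper)
qed

lemma bounded_by_mono: "bounded_by N M A \<Longrightarrow> M \<le> M' \<Longrightarrow> bounded_by N M' A"
  unfolding bounded_by_def by (meson order_trans)

text \<open>Let w be the image of v under the adjoint and u its normalisation. Then the norm of w is
  the inner product of u with w, which equals that of A u with v, and Cauchy-Schwarz
  applies.\<close>

lemma bounded_by_adjoint:
  assumes B: "bounded_by N M A"
  shows "bounded_by N M (mat_adjoint A)"
  unfolding bounded_by_def
proof (intro conjI ballI impI)
  have A: "A \<in> carrier_mat N N" using B by (simp add: bounded_by_def)
  thus "mat_adjoint A \<in> carrier_mat N N" by simp
  fix v :: "complex vec" assume v: "v \<in> carrier_vec N" "vnorm v \<le> 1"
  define w where "w = mat_adjoint A *\<^sub>v v"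
  have w: "w \<in> carrier_vec N" using A v by (simp add: w_def mult_mat_vec_carrier[of _ N N])
  \<comment> \<open>Tested on the zero vector; it settles the case in which \<open>w\<close>
    vanishes and cannot be normalised.\<close>
  have M: "M \<ge> 0"
  proof -
    have "vnorm (0\<^sub>v N) \<le> 1" by (simp add: vnorm_def)
    hence "vnorm (A *\<^sub>v 0\<^sub>v N) \<le> M" using B unfolding bounded_by_def by simp
    thus ?thesis by (rule order_trans[OF vnorm_nonneg])
  qed
  show "vnorm (mat_adjoint A *\<^sub>v v) \<le> M"
  proof (cases "vnorm w = 0")
    case True
    thus ?thesis using M by (simp add: w_def)
  next
    case False
    define u where "u = complex_of_real (1 / vnorm w) \<cdot>\<^sub>v w"
    have u: "u \<in> carrier_vec N" "vnorm u = 1" using w False by (simp_all add: u_def vnorm_smult norm_divide)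
    have "u \<bullet>c w = complex_of_real (vnorm w)"
      using w False cscalar_prod_self[of w]
      by (simp add: u_def power2_eq_square)
    moreover have "u \<bullet>c w = (A *\<^sub>v u) \<bullet>c v"
      unfolding w_def using adjoint_cscalar_prod[OF A u(1) v(1)] by simp
    ultimately have "vnorm w = cmod ((A *\<^sub>v u) \<bullet>c v)" by (metis abs_of_nonneg norm_of_real vnorm_nonneg)
    also have "\<dots> \<le> vnorm (A *\<^sub>v u) * vnorm v"
      using A u v by (intro cscalar_prod_le_vnorm[of _ N]) auto
    also have "\<dots> \<le> vnorm (A *\<^sub>v u)" using v by (simp add: mult_left_le)
    also have "\<dots> \<le> M" using B u by (simp add: bounded_by_def)
    finally show ?thesis by (simp add: w_def)
  qed
qed

text \<open>The outer factor \<open>mat_adjoint U\<close> preserves lengths, so column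
  \<open>j\<close> of the rebased matrix is as long as \<open>A\<close> applied to the unit vector
  \<open>col U j\<close>.\<close>

lemma bounded_by_rebase_col:
  assumes B: "bounded_by N M A" and U: "unitary N U" and j: "j < N"
  shows "(\<Sum>i<N. (cmod (rebase U A $$ (i, j)))\<^sup>2) \<le> M\<^sup>2"
proof -
  have A: "A \<in> carrier_mat N N" using B by (simp add: bounded_by_def)
  note c = unitary_carrier[OF U] A
  have norm_col: "(\<Sum>i<N. (cmod (X $$ (i, j)))\<^sup>2) = (vnorm (col X j))\<^sup>2" if "X \<in> carrier_mat N N" for X
    using that j by (simp add: vnorm_def sum_nonneg)
  have "complex_of_real (\<Sum>i<N. (cmod (rebase U A $$ (i, j)))\<^sup>2)
      = (mat_adjoint (rebase U A) * rebase U A) $$ (j, j)"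
    using adjoint_mult_self_diag[OF rebase_carrier[OF U A] j] by simp
  also have "mat_adjoint (rebase U A) * rebase U A = mat_adjoint (A * U) * (A * U)"
    using c
    by (simp add: rebase_def sq_mat_assoc[where N = N] mat_adjoint_mult[where n = N and m = N and p = N]
        unitary_cancel[OF U] mult_carrier_mat[where nr = N and n = N and nc = N])
  also have "\<dots> $$ (j, j) = complex_of_real (\<Sum>i<N. (cmod ((A * U) $$ (i, j)))\<^sup>2)"
    using c by (intro adjoint_mult_self_diag[OF _ j]) simp
  finally have "(\<Sum>i<N. (cmod (rebase U A $$ (i, j)))\<^sup>2) = (\<Sum>i<N. (cmod ((A * U) $$ (i, j)))\<^sup>2)"
    by (simp only: of_real_eq_iff)
  also have "\<dots> = (vnorm (A *\<^sub>v col U j))\<^sup>2"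
    using norm_col[of "A * U"] col_mult2[OF c(3) c(1) j] c
    by (simp only: mult_carrier_mat[where nr = N and n = N and nc = N])
  also have "\<dots> \<le> M\<^sup>2"
  proof -
    have "complex_of_real ((vnorm (col U j))\<^sup>2) = (mat_adjoint U * U) $$ (j, j)"
      using adjoint_mult_self_diag[OF c(1) j] norm_col[OF c(1)] by simp
    also have "\<dots> = complex_of_real 1" using U j by (simp add: unitary_def)
    finally have "(vnorm (col U j))\<^sup>2 = 1" by (simp only: of_real_eq_iff)
    hence "vnorm (col U j) \<le> 1" by (auto simp: power2_eq_1_iff)
    moreover have "col U j \<in> carrier_vec N" using c by auto
    ultimately have "vnorm (A *\<^sub>v col U j) \<le> M" using B by (simp add: bounded_by_def)
    thus ?thesis by (simp add: power_mono)
  qed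
  finally show ?thesis .
qed

text \<open>Rows are conjugated columns of the adjoint, which obeys the same bound.\<close>

lemma bounded_by_rebase_row:
  assumes B: "bounded_by N M A" and U: "unitary N U" and j: "j < N"
  shows "(\<Sum>i<N. (cmod (rebase U A $$ (j, i)))\<^sup>2) \<le> M\<^sup>2"
proof -
  have A: "A \<in> carrier_mat N N" using B by (simp add: bounded_by_def)
  have "(\<Sum>i<N. (cmod (rebase U (mat_adjoint A) $$ (i, j)))\<^sup>2) = (\<Sum>i<N. (cmod (rebase U A $$ (j, i)))\<^sup>2)"
    using j rebase_carrier[OF U A]
    by (intro sum.cong) (auto simp: rebase_adjoint[OF U A] mat_adjoint_index)
  thus ?thesis using bounded_by_rebase_col[OF bounded_by_adjoint[OF B] U j] by simp
qed

lemma unitary_one: "unitary N (1\<^sub>m N)"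
proof -
  have "mat_adjoint (1\<^sub>m N) = (1\<^sub>m N :: complex mat)"
    by (rule eq_matI) (simp_all add: mat_adjoint_index)
  thus ?thesis by (simp add: unitary_def)
qed

text \<open>Each of the \<open>N\<close> rows has squared length at most \<open>M\<close> squared;
  the row bound is used with the identity as change of basis.\<close>

lemma bounded_by_frob_sq:
  assumes B: "bounded_by N M A"
  shows "frob_sq A \<le> real N * M\<^sup>2"
proof -
  have A: "A \<in> carrier_mat N N" using B by (simp add: bounded_by_def)
  have "frob_sq A = frob_sq (rebase (1\<^sub>m N) A)"
    by (rule frob_sq_rebase[OF unitary_one A, symmetric])
  also have "\<dots> = (\<Sum>i<N. \<Sum>j<N. (cmod (rebase (1\<^sub>m N) A $$ (i, j)))\<^sup>2)"
    using rebase_carrier[OF unitary_one A] by (simp add: frob_sq_def)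
  also have "\<dots> \<le> (\<Sum>i<N. M\<^sup>2)"
    by (intro sum_mono bounded_by_rebase_row[OF B unitary_one]) simp
  finally show ?thesis by simp
qed

section \<open>Diagonalization and time averages\<close>

lemma rebase_diag_index:
  assumes U: "unitary N U" and ab: "a < N" "b < N"
  shows "(U * mat_diag N f * mat_adjoint U) $$ (a, b) = (\<Sum>j<N. U $$ (a, j) * f j * cnj (U $$ (b, j)))"
proof -
  note c = unitary_carrier[OF U]
  have "U * mat_diag N f = mat N N (\<lambda>(i, j). U $$ (i, j) * f j)"
    by (rule mat_diag_mult_right[OF c(1)])
  thus ?thesis
    using c ab by (subst mat_mult_index[of _ N N _ N]) (auto simp: mat_adjoint_index intro!: sum.cong)
qed

text \<open>The gap condition makes the \<open>N\<close> listed roots distinct. One unit eigenvector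
  per root is then enough: eigenvectors of a Hermitian matrix for different eigenvalues are
  orthogonal, so these \<open>N\<close> vectors are the columns of a unitary matrix.\<close>

lemma spectral_theorem_nondeg:
  assumes H: "H \<in> carrier_mat N N" "mat_adjoint H = H" and gaps: "nondeg_gaps H"
  obtains U and E :: "nat \<Rightarrow> real" where
    "unitary N U" "H = U * mat_diag N (\<lambda>j. complex_of_real (E j)) * mat_adjoint U"
    "\<And>j k l m. \<lbrakk>j < N; k < N; l < N; m < N; j \<noteq> k; E j - E k = E l - E m\<rbrakk> \<Longrightarrow> j = l \<and> k = m"
proof -
  obtain es :: "complex list" where len: "length es = N"
    and cp: "char_poly H = (\<Prod>e\<leftarrow>es. [:- e, 1:])"
    and g: "\<And>j k l m. \<lbrakk>j < N; k < N; l < N; m < N; j \<noteq> k; es ! j - es ! k = es ! l - es ! m\<rbrakk> \<Longrightarrow> j = l \<and> k = m"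
    using gaps H(1) unfolding nondeg_gaps_def by (metis carrier_matD(1))
  \<comment> \<open>A coincidence would make the gap between \<open>j\<close> and \<open>k\<close>
    equal to the trivial gap between \<open>j\<close> and \<open>j\<close>.\<close>
  have dist: "es ! j \<noteq> es ! k" if "j < N" "k < N" "j \<noteq> k" for j k
    using g[OF that(1,2) that(1,1) that(3)] that(3) by auto
  have "\<exists>u. u \<in> carrier_vec N \<and> vnorm u = 1 \<and> H *\<^sub>v u = es ! j \<cdot>\<^sub>v u" if j: "j < N" for j
  proof -
    have "poly (char_poly H) (es ! j) = 0"
      using j len unfolding cp by (auto simp: poly_prod_list prod_list_zero_iff)
    hence "eigenvalue H (es ! j)" using eigenvalue_root_char_poly[OF H(1)] by simp
    then obtain v where v: "v \<in> carrier_vec N" "v \<noteq> 0\<^sub>v N" "H *\<^sub>v v = es ! j \<cdot>\<^sub>v v"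
      using H(1) unfolding eigenvalue_def eigenvector_def by auto
    have "v \<bullet>c v \<noteq> 0" using v(1,2) by (simp add: conjugate_square_eq_0_vec[OF v(1)])
    hence nz: "vnorm v \<noteq> 0" by (auto simp: cscalar_prod_self)
    let ?u = "complex_of_real (1 / vnorm v) \<cdot>\<^sub>v v"
    have "vnorm ?u = 1" using nz by (simp add: vnorm_smult norm_divide)
    moreover have "H *\<^sub>v ?u = es ! j \<cdot>\<^sub>v ?u"
      using H(1) v by (simp add: mult_mat_vec smult_smult_assoc mult.commute)
    ultimately show ?thesis using v(1) by (intro exI[of _ ?u]) simp
  qed
  then obtain u where u: "\<And>j. j < N \<Longrightarrow> u j \<in> carrier_vec N" "\<And>j. j < N \<Longrightarrow> vnorm (u j) = 1"
    "\<And>j. j < N \<Longrightarrow> H *\<^sub>v u j = es ! j \<cdot>\<^sub>v u j"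
    by metis
  have herm: "es ! j * (u j \<bullet>c u k) = cnj (es ! k) * (u j \<bullet>c u k)" if jk: "j < N" "k < N" for j k
  proof -
    have "(H *\<^sub>v u j) \<bullet>c u k = u j \<bullet>c (H *\<^sub>v u k)"
      using adjoint_cscalar_prod[OF H(1) u(1)[OF jk(1)] u(1)[OF jk(2)]] H(2) by simp
    thus ?thesis using u(3)[OF jk(1)] u(3)[OF jk(2)] u(1)[OF jk(1)] u(1)[OF jk(2)]
      by (simp add: conjugate_smult_vec)
  qed
  have uu: "u j \<bullet>c u j = 1" if "j < N" for j
    using u(2)[OF that] by (simp add: cscalar_prod_self)
  \<comment> \<open>For \<open>j = k\<close> and a unit vector, \<open>herm\<close> says that the
    eigenvalue equals its own conjugate.\<close>
  have real: "es ! j = complex_of_real (Re (es ! j))" if "j < N" for j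
    using herm[OF that that] uu[OF that] by (simp add: complex_eq_iff)
  have orth: "u j \<bullet>c u k = 0" if "j < N" "k < N" "j \<noteq> k" for j k
  proof -
    have "cnj (es ! k) = es ! k" using real[OF that(2)] by (metis complex_cnj_complex_of_real)
    thus ?thesis using herm[OF that(1,2)] dist[OF that] by simp
  qed
  define U where "U = mat N N (\<lambda>(i, j). vec_index (u j) i)"
  define E where "E = (\<lambda>j. Re (es ! j))"
  have Uc: "U \<in> carrier_mat N N" by (simp add: U_def)
  have "mat_adjoint U * U = 1\<^sub>m N"
  proof (rule eq_matI)
    fix i j assume "i < dim_row (1\<^sub>m N :: complex mat)" "j < dim_col (1\<^sub>m N :: complex mat)"
    hence ij: "i < N" "j < N" by auto
    have "(mat_adjoint U * U) $$ (i, j) = (\<Sum>k<N. vec_index (u j) k * cnj (vec_index (u i) k))"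
      using ij Uc by (subst mat_mult_index[of _ N N _ N])
        (auto simp: mat_adjoint_index U_def mult.commute intro!: sum.cong)
    also have "\<dots> = u j \<bullet>c u i" using cscalar_prod_sum[of "u j" N "u i"] u(1) ij by simp
    also have "\<dots> = 1\<^sub>m N $$ (i, j)" using uu orth ij by auto
    finally show "(mat_adjoint U * U) $$ (i, j) = 1\<^sub>m N $$ (i, j)" .
  qed (use Uc in auto)
  hence UU: "unitary N U" by (rule unitaryI[OF Uc])
  have HU: "H * U = U * mat_diag N (\<lambda>j. complex_of_real (E j))"
  proof (rule eq_matI)
    fix i j assume "i < dim_row (U * mat_diag N (\<lambda>j. complex_of_real (E j)))"
      "j < dim_col (U * mat_diag N (\<lambda>j. complex_of_real (E j)))"
    hence ij: "i < N" "j < N" using Uc by (auto simp: mat_diag_def)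
    have "(H * U) $$ (i, j) = vec_index (H *\<^sub>v u j) i"
      using ij H(1) Uc u(1)[OF ij(2)]
      by (simp only: mat_mult_index[of _ N N _ N] mult_mat_vec_index[of _ N N]) (simp add: U_def)
    also have "\<dots> = vec_index (u j) i * complex_of_real (E j)"
      using u(3)[OF ij(2)] u(1)[OF ij(2)] ij real[OF ij(2)] by (simp add: E_def mult.commute)
    also have "\<dots> = (U * mat_diag N (\<lambda>j. complex_of_real (E j))) $$ (i, j)"
      unfolding mat_diag_mult_right[OF Uc] using ij by (simp add: U_def)
    finally show "(H * U) $$ (i, j) = (U * mat_diag N (\<lambda>j. complex_of_real (E j))) $$ (i, j)" .
  qed (use Uc H in \<open>auto simp: mat_diag_def\<close>)
  have "H = H * (U * mat_adjoint U)" using UU H(1) by (simp add: unitary_def)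
  also have "\<dots> = U * mat_diag N (\<lambda>j. complex_of_real (E j)) * mat_adjoint U"
    using sq_mat_assoc[OF H(1) unitary_carrier[OF UU]] HU by simp
  finally have HE: "H = U * mat_diag N (\<lambda>j. complex_of_real (E j)) * mat_adjoint U" .
  show thesis
  proof (rule that[OF UU HE])
    fix j k l m assume *: "j < N" "k < N" "l < N" "m < N" "j \<noteq> k" "E j - E k = E l - E m"
    have "es ! j - es ! k = es ! l - es ! m"
      using real[OF *(1)] real[OF *(2)] real[OF *(3)] real[OF *(4)] *(6) unfolding E_def
      by (metis of_real_diff)
    thus "j = l \<and> k = m" by (rule g[OF *(1-5)])
  qed
qed

section \<open>Time evolution in the eigenbasis\<close>

text \<open>Powers act on the eigenvalues alone, so each entry of the exponential series is a finite
  combination of scalar exponential series, which may be summed termwise.\<close>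

lemma mexp_diagonalized:
  assumes U: "unitary N U"
  shows "mexp (c \<cdot>\<^sub>m (U * mat_diag N f * mat_adjoint U)) = U * mat_diag N (\<lambda>j. exp (c * f j)) * mat_adjoint U"
proof -
  note carr = unitary_carrier[OF U]
  let ?D = "\<lambda>f. U * mat_diag N f * mat_adjoint U"
  have Dc: "?D f \<in> carrier_mat N N" for f using carr
    by (simp add: mult_carrier_mat[where nr = N and n = N and nc = N])
  have smult: "c \<cdot>\<^sub>m ?D f = ?D (\<lambda>j. c * f j)"
    using Dc[of f] Dc[of "\<lambda>j. c * f j"]
    by (intro eq_matI)
       (auto simp: rebase_diag_index[OF U] sum_distrib_left mult_ac simp del: index_mult_mat(1) intro!: sum.cong)
  have mult: "?D f * ?D g = ?D (\<lambda>j. f j * g j)" for f g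
  proof -
    have "?D f * ?D g = U * (mat_diag N f * (mat_adjoint U * (U * (mat_diag N g * mat_adjoint U))))"
      using carr by (simp add: sq_mat_assoc[where N = N] mult_carrier_mat[where nr = N and n = N and nc = N])
    also have "\<dots> = U * (mat_diag N f * (mat_diag N g * mat_adjoint U))"
      using carr by (subst unitary_cancel[OF U]) (simp_all add: mult_carrier_mat[where nr = N and n = N and nc = N])
    also have "\<dots> = U * (mat_diag N f * mat_diag N g) * mat_adjoint U"
      using carr by (simp add: sq_mat_assoc[where N = N] mult_carrier_mat[where nr = N and n = N and nc = N]
        del: mat_diag_diag)
    finally show ?thesis by simp
  qed
  have pow: "?D f ^\<^sub>m k = ?D (\<lambda>j. f j ^ k)" for f k
  proof (induction k)
    case 0
    have "dim_row (?D f) = N" using Dc by (rule carrier_matD(1))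
    moreover have "?D (\<lambda>j. 1) = 1\<^sub>m N" using U carr by (simp add: unitary_def)
    ultimately show ?case by simp
  next
    case (Suc k)
    thus ?case by (simp add: mult mult.commute)
  qed
  show ?thesis
  proof (rule eq_matI)
    fix a b assume "a < dim_row (?D (\<lambda>j. exp (c * f j)))" "b < dim_col (?D (\<lambda>j. exp (c * f j)))"
    hence ab: "a < N" "b < N" using Dc[of "\<lambda>j. exp (c * f j)"] by auto
    have "(\<lambda>k. (\<Sum>j<N. U $$ (a, j) * ((c * f j) ^ k / of_nat (fact k)) * cnj (U $$ (b, j))))
        sums (\<Sum>j<N. U $$ (a, j) * exp (c * f j) * cnj (U $$ (b, j)))"
    proof (intro sums_sum sums_mult sums_mult2)
      fix j
      show "(\<lambda>k. (c * f j) ^ k / of_nat (fact k)) sums exp (c * f j)"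
        using exp_converges[of "c * f j"] by (simp add: scaleR_conv_of_real divide_inverse mult.commute)
    qed
    hence "(\<lambda>k. (?D (\<lambda>j. c * f j) ^\<^sub>m k) $$ (a, b) / of_nat (fact k))
        sums (\<Sum>j<N. U $$ (a, j) * exp (c * f j) * cnj (U $$ (b, j)))"
      unfolding pow rebase_diag_index[OF U ab] by (simp add: sum_divide_distrib)
    thus "mexp (c \<cdot>\<^sub>m ?D f) $$ (a, b) = ?D (\<lambda>j. exp (c * f j)) $$ (a, b)"
      unfolding smult rebase_diag_index[OF U ab] using carr ab
      by (simp add: mexp_def sums_unique[symmetric] del: index_mult_mat(1))
  qed (use Dc[of "\<lambda>j. exp (c * f j)"] Dc[of f] carr in \<open>auto simp: mexp_def\<close>)
qed

lemma heis_diagonalized: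
  assumes U: "unitary N U"
    and H: "H = U * mat_diag N (\<lambda>j. complex_of_real (E j)) * mat_adjoint U"
  shows "heis H t A = (U * mat_diag N (\<lambda>j. exp (\<i> * of_real t * complex_of_real (E j))) * mat_adjoint U) * A *
    (U * mat_diag N (\<lambda>j. exp (- \<i> * of_real t * complex_of_real (E j))) * mat_adjoint U)"
  unfolding heis_def H mexp_diagonalized[OF U] ..

lemma heis_carrier:
  assumes U: "unitary N U" and A: "A \<in> carrier_mat N N"
    and H: "H = U * mat_diag N (\<lambda>j. complex_of_real (E j)) * mat_adjoint U"
  shows "heis H t A \<in> carrier_mat N N"
  unfolding heis_diagonalized[OF U H] using unitary_carrier[OF U] A
  by (simp add: mult_carrier_mat[where nr = N and n = N and nc = N])

text \<open>In the eigenbasis both exponentials are diagonal; the left one scales row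
  \<open>j\<close> and the right one scales column \<open>k\<close>.\<close>

lemma rebase_heis_index:
  assumes U: "unitary N U" and A: "A \<in> carrier_mat N N"
    and H: "H = U * mat_diag N (\<lambda>j. complex_of_real (E j)) * mat_adjoint U"
    and jk: "j < N" "k < N"
  shows "rebase U (heis H t A) $$ (j, k) = exp (\<i> * of_real (t * (E j - E k))) * rebase U A $$ (j, k)"
proof -
  note carr = unitary_carrier[OF U] A
  let ?L = "\<lambda>s. mat_diag N (\<lambda>j. exp (s * complex_of_real (E j)))"
  have hc: "U * ?L s * mat_adjoint U \<in> carrier_mat N N" for s
    using carr by (simp add: mult_carrier_mat[where nr = N and n = N and nc = N])
  have "rebase U (heis H t A) = ?L (\<i> * of_real t) * rebase U A * ?L (- \<i> * of_real t)"
    unfolding heis_diagonalized[OF U H]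
    by (simp only: rebase_mult[OF U] hc A mult_carrier_mat[where nr = N and n = N and nc = N]
        rebase_inverse[OF U] mat_diag_dim)
  also have "\<dots> $$ (j, k) = exp (\<i> * of_real t * of_real (E j)) * rebase U A $$ (j, k) * exp (- \<i> * of_real t * of_real (E k))"
    using jk rebase_carrier[OF U A]
    by (simp add: mat_diag_mult_left[of _ N N] mat_diag_mult_right[of _ N N] del: index_mult_mat(1))
  also have "\<dots> = exp (\<i> * of_real (t * (E j - E k))) * rebase U A $$ (j, k)"
    by (simp add: algebra_simps exp_diff exp_minus field_simps)
  finally show "rebase U (heis H t A) $$ (j, k) = exp (\<i> * of_real (t * (E j - E k))) * rebase U A $$ (j, k)" .
qed

lemma mtrace_otoc_product:
  assumes X: "X \<in> carrier_mat N N" and B: "B \<in> carrier_mat N N"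
  shows "mtrace (mat_adjoint X * mat_adjoint B * X * B) =
    (\<Sum>j<N. \<Sum>k<N. \<Sum>l<N. \<Sum>m<N. cnj (X $$ (k, j)) * cnj (B $$ (l, k)) * X $$ (l, m) * B $$ (m, j))"
proof -
  have c: "mat_adjoint X * mat_adjoint B * X * B = mat_adjoint X * (mat_adjoint B * (X * B))"
    using X B by (simp add: sq_mat_assoc[where N = N] mult_carrier_mat[where nr = N and n = N and nc = N])
  have XB: "X * B \<in> carrier_mat N N" "mat_adjoint B * (X * B) \<in> carrier_mat N N"
    using X B by (simp_all add: mult_carrier_mat[where nr = N and n = N and nc = N])
  have "(mat_adjoint X * (mat_adjoint B * (X * B))) $$ (j, j) =
      (\<Sum>k<N. \<Sum>l<N. \<Sum>m<N. cnj (X $$ (k, j)) * cnj (B $$ (l, k)) * X $$ (l, m) * B $$ (m, j))"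
    if j: "j < N" for j
  proof -
    have "(mat_adjoint X * (mat_adjoint B * (X * B))) $$ (j, j)
        = (\<Sum>k<N. cnj (X $$ (k, j)) * (mat_adjoint B * (X * B)) $$ (k, j))"
      using X j by (subst mat_mult_index[OF mat_adjoint_carrier[OF X] XB(2)])
        (auto simp: mat_adjoint_index simp del: index_mult_mat(1) intro!: sum.cong)
    also have "\<dots> = (\<Sum>k<N. cnj (X $$ (k, j)) * (\<Sum>l<N. cnj (B $$ (l, k)) * (X * B) $$ (l, j)))"
      using B j by (simp add: mat_mult_index[OF mat_adjoint_carrier[OF B] XB(1)] mat_adjoint_index
        del: index_mult_mat(1))
    also have "\<dots> = (\<Sum>k<N. cnj (X $$ (k, j)) * (\<Sum>l<N. cnj (B $$ (l, k)) * (\<Sum>m<N. X $$ (l, m) * B $$ (m, j))))"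
      using j by (simp add: mat_mult_index[OF X B] del: index_mult_mat(1))
    also have "\<dots> = (\<Sum>k<N. \<Sum>l<N. \<Sum>m<N. cnj (X $$ (k, j)) * cnj (B $$ (l, k)) * X $$ (l, m) * B $$ (m, j))"
      by (simp add: sum_distrib_left mult.assoc)
    finally show ?thesis .
  qed
  thus ?thesis unfolding c using X by (simp add: mtrace_def del: index_mult_mat(1))
qed

section \<open>Infinite-time averages\<close>

text \<open>At nonzero frequency the antiderivative is bounded, so the integral stays below
  \<open>2 / \<bar>w\<bar>\<close> for every positive \<tau> and division by \<tau> sends it to
  zero. At frequency zero the average is constantly one.\<close>

lemma time_average_exp:
  "((\<lambda>\<tau>. integral {0..\<tau>} (\<lambda>t. exp (\<i> * of_real (t * w))) / complex_of_real \<tau>)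
     \<longlongrightarrow> (if w = 0 then 1 else 0)) at_top"
proof (cases "w = 0")
  case True
  have "eventually (\<lambda>\<tau>. integral {0..\<tau>} (\<lambda>t. exp (\<i> * of_real (t * w))) / complex_of_real \<tau> = 1) at_top"
    using eventually_gt_at_top[of "0 :: real"]
  proof eventually_elim
    fix \<tau> :: real assume \<tau>: "\<tau> > 0"
    have "integral {0..\<tau>} (\<lambda>t. exp (\<i> * of_real (t * w))) = integral {0..\<tau>} (\<lambda>t. 1 :: complex)"
      unfolding True by simp
    also have "\<dots> = measure lborel {0..\<tau>} *\<^sub>R 1" by (rule integral_const_real)
    also have "\<dots> = complex_of_real \<tau>" using \<tau> by (simp add: of_real_def)
    finally show "integral {0..\<tau>} (\<lambda>t. exp (\<i> * of_real (t * w))) / complex_of_real \<tau> = 1"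
      using \<tau> by simp
  qed
  thus ?thesis unfolding if_P[OF True] by (rule tendsto_eventually)
next
  case False
  have "eventually (\<lambda>\<tau>. norm (integral {0..\<tau>} (\<lambda>t. exp (\<i> * of_real (t * w))) / complex_of_real \<tau>)
      \<le> (2 / \<bar>w\<bar>) / \<tau>) at_top"
    using eventually_gt_at_top[of "0 :: real"]
  proof eventually_elim
    fix \<tau> :: real assume \<tau>: "\<tau> > 0"
    let ?F = "\<lambda>t. exp (\<i> * complex_of_real (t * w)) / (\<i> * of_real w)"
    have "((\<lambda>t. exp (\<i> * complex_of_real (t * w))) has_integral ?F \<tau> - ?F 0) {0..\<tau>}"
    proof (rule fundamental_theorem_of_calculus)
      fix t assume "t \<in> {0..\<tau>}"
      show "(?F has_vector_derivative exp (\<i> * complex_of_real (t * w))) (at t within {0..\<tau>})"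
      proof -
        define c where "c = \<i> * complex_of_real w"
        have c: "c \<noteq> 0" using False by (simp add: c_def)
        have "((\<lambda>z. exp (c * z) / c) has_field_derivative exp (c * of_real t) * c / c) (at (of_real t))"
          by (intro DERIV_cdivide DERIV_fun_exp DERIV_cmult_Id)
        hence "((\<lambda>z. exp (c * z) / c) has_field_derivative exp (c * of_real t)) (at (of_real t))"
          using c by simp
        from has_vector_derivative_real_field[OF this] show ?thesis
          by (simp add: c_def mult_ac)
      qed
    qed (use \<tau> in simp)
    hence "integral {0..\<tau>} (\<lambda>t. exp (\<i> * complex_of_real (t * w))) = ?F \<tau> - ?F 0"
      by (rule integral_unique)
    moreover have "norm (?F \<tau> - ?F 0) \<le> norm (?F \<tau>) + norm (?F 0)" by (rule norm_triangle_ineq4)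
    moreover have "norm (?F t) = 1 / \<bar>w\<bar>" for t by (simp add: norm_divide norm_mult norm_exp_i_times)
    ultimately have "norm (integral {0..\<tau>} (\<lambda>t. exp (\<i> * complex_of_real (t * w)))) \<le> 2 / \<bar>w\<bar>"
      by (metis add_divide_distrib one_add_one)
    from divide_right_mono[OF this, of \<tau>] \<tau>
    show "norm (integral {0..\<tau>} (\<lambda>t. exp (\<i> * of_real (t * w))) / complex_of_real \<tau>) \<le> (2 / \<bar>w\<bar>) / \<tau>"
      by (simp add: norm_divide)
  qed
  moreover have "((\<lambda>\<tau>::real. (2 / \<bar>w\<bar>) / \<tau>) \<longlongrightarrow> 0) at_top"
    by (rule tendsto_divide_0[OF tendsto_const]) (simp add: filterlim_at_top_imp_at_infinity filterlim_ident)
  ultimately show ?thesis unfolding if_not_P[OF False] by (rule Lim_null_comparison)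
qed

lemma time_average_trig_sum:
  assumes "finite Q"
  shows "((\<lambda>\<tau>. integral {0..\<tau>} (\<lambda>t. \<Sum>q\<in>Q. c q * exp (\<i> * of_real (t * w q))) / complex_of_real \<tau>)
     \<longlongrightarrow> (\<Sum>q\<in>Q. if w q = 0 then c q else 0)) at_top"
proof -
  have int: "integral {0..\<tau>} (\<lambda>t. \<Sum>q\<in>Q. c q * exp (\<i> * of_real (t * w q)))
      = (\<Sum>q\<in>Q. c q * integral {0..\<tau>} (\<lambda>t. exp (\<i> * of_real (t * w q))))" for \<tau>
  proof -
    have "(\<lambda>t. c q * exp (\<i> * complex_of_real (t * w q))) integrable_on {0..\<tau>}" for q
      by (intro integrable_continuous_real continuous_intros)
    thus ?thesis using assms by (subst integral_sum) (simp_all only: integral_mult_right)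
  qed
  have "((\<lambda>\<tau>. \<Sum>q\<in>Q. c q * (integral {0..\<tau>} (\<lambda>t. exp (\<i> * of_real (t * w q))) / complex_of_real \<tau>))
     \<longlongrightarrow> (\<Sum>q\<in>Q. c q * (if w q = 0 then 1 else 0))) at_top"
    by (intro tendsto_sum tendsto_mult tendsto_const time_average_exp)
  thus ?thesis unfolding int by (simp add: sum_divide_distrib if_distrib cong: if_cong)
qed

section \<open>Averaging over translations\<close>

text \<open>The columns are standard basis vectors, pairwise different because \<open>shift\<close>
  is injective.\<close>

lemma unitary_transl:
  assumes d: "d > 0"
  shows "unitary (d ^ n) (transl d n)"
proof (rule unitaryI)
  let ?T = "transl d n" and ?N = "d ^ n"
  show T: "?T \<in> carrier_mat ?N ?N" by (simp add: transl_def)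
  show "mat_adjoint ?T * ?T = 1\<^sub>m ?N"
  proof (rule eq_matI)
    fix i j assume "i < dim_row (1\<^sub>m ?N :: complex mat)" "j < dim_col (1\<^sub>m ?N :: complex mat)"
    hence ij: "i < ?N" "j < ?N" by auto
    have "(mat_adjoint ?T * ?T) $$ (i, j) = (\<Sum>k<?N. cnj (?T $$ (k, i)) * ?T $$ (k, j))"
      using ij T by (subst mat_mult_index[of _ ?N ?N _ ?N]) (auto simp: mat_adjoint_index)
    also have "\<dots> = (\<Sum>k<?N. if k = shift d n i then if shift d n i = shift d n j then 1 else 0 else 0)"
      using ij by (intro sum.cong) (auto simp: transl_index[OF d])
    also have "\<dots> = (if shift d n i = shift d n j then 1 else 0)"
      using shift(1)[OF d] by simp
    also have "\<dots> = 1\<^sub>m ?N $$ (i, j)" using ij shift_inj[OF d ij] by auto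
    finally show "(mat_adjoint ?T * ?T) $$ (i, j) = 1\<^sub>m ?N $$ (i, j)" .
  qed (use T in auto)
qed

lemma rebase_index:
  assumes U: "U \<in> carrier_mat N N" and X: "X \<in> carrier_mat N N" and ij: "i < N" "j < N"
  shows "rebase U X $$ (i, j) = (\<Sum>b<N. (\<Sum>a<N. cnj (U $$ (a, i)) * X $$ (a, b)) * U $$ (b, j))"
proof -
  have UX: "mat_adjoint U * X \<in> carrier_mat N N"
    using U X by (simp add: mult_carrier_mat[where nr = N and n = N and nc = N])
  have "rebase U X $$ (i, j) = (\<Sum>b<N. (mat_adjoint U * X) $$ (i, b) * U $$ (b, j))"
    unfolding rebase_def by (rule mat_mult_index[OF UX U ij])
  also have "\<dots> = (\<Sum>b<N. (\<Sum>a<N. mat_adjoint U $$ (i, a) * X $$ (a, b)) * U $$ (b, j))"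
    using ij by (simp add: mat_mult_index[OF mat_adjoint_carrier[OF U] X] del: index_mult_mat(1))
  finally show ?thesis using U ij by (simp add: mat_adjoint_index)
qed

text \<open>Links the relabelling of indices to conjugation by the translation matrix, one step at a
  time, so that invariance under a symmetry of the Hamiltonian can be iterated.\<close>

lemma translate_Suc:
  assumes d: "d > 0"
  shows "translate d n (Suc k) A = rebase (transl d n) (translate d n k A)"
proof (rule eq_matI)
  let ?T = "transl d n" and ?N = "d ^ n" and ?X = "translate d n k A"
  have T: "?T \<in> carrier_mat ?N ?N" by (simp add: transl_def)
  have R: "rebase ?T ?X \<in> carrier_mat ?N ?N" by (rule rebase_carrier[OF unitary_transl[OF d]]) simp
  fix i j assume "i < dim_row (rebase ?T ?X)" "j < dim_col (rebase ?T ?X)"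
  hence ij: "i < ?N" "j < ?N" using R by auto
  have "rebase ?T ?X $$ (i, j) = (\<Sum>b<?N. (\<Sum>a<?N. cnj (?T $$ (a, i)) * ?X $$ (a, b)) * ?T $$ (b, j))"
    by (rule rebase_index[OF T _ ij]) simp
  also have "\<dots> = (\<Sum>b<?N. ?X $$ (shift d n i, b) * ?T $$ (b, j))"
  proof (intro sum.cong refl arg_cong2[where f = "(*)"])
    fix b
    have "(\<Sum>a<?N. cnj (?T $$ (a, i)) * ?X $$ (a, b)) = (\<Sum>a<?N. if a = shift d n i then ?X $$ (a, b) else 0)"
      using ij by (intro sum.cong) (auto simp: transl_index[OF d])
    thus "(\<Sum>a<?N. cnj (?T $$ (a, i)) * ?X $$ (a, b)) = ?X $$ (shift d n i, b)"
      using shift(1)[OF d] by simp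
  qed
  also have "\<dots> = (\<Sum>b<?N. if b = shift d n j then ?X $$ (shift d n i, b) else 0)"
    using ij by (intro sum.cong) (auto simp: transl_index[OF d])
  also have "\<dots> = ?X $$ (shift d n i, shift d n j)"
    using shift(1)[OF d] by simp
  also have "\<dots> = translate d n (Suc k) A $$ (i, j)"
    using ij shift(1)[OF d] by (simp add: translate_def funpow_swap1)
  finally show "translate d n (Suc k) A $$ (i, j) = rebase ?T ?X $$ (i, j)" by simp
qed (simp_all only: carrier_matD[OF translate_carrier]
      carrier_matD[OF rebase_carrier[OF unitary_transl[OF d] translate_carrier]])

text \<open>As \<open>H\<close> has simple spectrum, the symmetry \<open>T\<close> is diagonal with unimodular entries in the
  eigenbasis of \<open>H\<close>, so conjugation by \<open>T\<close> preserves the diagonal.\<close>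

lemma rebase_symmetry_diag:
  assumes U: "unitary N U" and T: "unitary N T" and X: "X \<in> carrier_mat N N"
    and H: "H = U * mat_diag N e * mat_adjoint U" and comm: "H * T = T * H"
    and inj: "inj_on e {..<N}" and j: "j < N"
  shows "rebase U (rebase T X) $$ (j, j) = rebase U X $$ (j, j)"
proof -
  note Tc = unitary_carrier[OF T]
  define W where "W = rebase U T"
  have W: "W \<in> carrier_mat N N" unfolding W_def by (rule rebase_carrier[OF U Tc(1)])
  have Hc: "H \<in> carrier_mat N N" unfolding H using unitary_carrier[OF U]
    by (simp add: mult_carrier_mat[where nr = N and n = N and nc = N])
  have "rebase U H = mat_diag N e" unfolding H by (rule rebase_inverse(1)[OF U]) simp
  hence comm': "mat_diag N e * W = W * mat_diag N e"
    using rebase_mult[OF U Hc Tc(1)] rebase_mult[OF U Tc(1) Hc] comm by (simp add: W_def)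
  have off: "W $$ (i, k) = 0" if "i < N" "k < N" "i \<noteq> k" for i k
  proof -
    have "(mat_diag N e * W) $$ (i, k) = (W * mat_diag N e) $$ (i, k)" using comm' by simp
    hence "e i * W $$ (i, k) = W $$ (i, k) * e k"
      unfolding mat_diag_mult_left[OF W] mat_diag_mult_right[OF W] using that by simp
    moreover have "e i \<noteq> e k" using inj that by (simp add: inj_on_eq_iff)
    ultimately show ?thesis by (simp add: mult.commute)
  qed
  have "unitary N W"
  proof (rule unitaryI[OF W])
    have "mat_adjoint W * W = rebase U (mat_adjoint T * T)"
      using Tc by (simp add: W_def rebase_mult[OF U] rebase_adjoint[OF U])
    also have "\<dots> = 1\<^sub>m N" using T U unitary_carrier[OF U] by (simp add: unitary_def rebase_def)
    finally show "mat_adjoint W * W = 1\<^sub>m N" .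
  qed
  hence "complex_of_real (\<Sum>i<N. (cmod (W $$ (i, j)))\<^sup>2) = 1"
    using adjoint_mult_self_diag[OF W j] j by (simp add: unitary_def)
  also have "(\<Sum>i<N. (cmod (W $$ (i, j)))\<^sup>2) = (\<Sum>i<N. if i = j then (cmod (W $$ (j, j)))\<^sup>2 else 0)"
    using off j by (intro sum.cong) auto
  also have "\<dots> = (cmod (W $$ (j, j)))\<^sup>2" using j by simp
  finally have unimod: "cnj (W $$ (j, j)) * W $$ (j, j) = 1"
    by (simp only: complex_norm_square mult.commute)
  define Y where "Y = rebase U X"
  have Y: "Y \<in> carrier_mat N N" unfolding Y_def by (rule rebase_carrier[OF U X])
  \<comment> \<open>Since \<open>rebase U\<close> respects products and adjoints, conjugation by
    \<open>T\<close> turns into conjugation by its diagonal form \<open>W\<close> in the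
    eigenbasis.\<close>
  have "rebase U (rebase T X) = mat_adjoint W * Y * W"
    unfolding rebase_def[of T] W_def Y_def using Tc X
    by (simp add: rebase_mult[OF U] rebase_adjoint[OF U] mult_carrier_mat[where nr = N and n = N and nc = N])
  hence "rebase U (rebase T X) = rebase W Y" unfolding rebase_def[of W] .
  hence "rebase U (rebase T X) $$ (j, j) = (\<Sum>b<N. (\<Sum>a<N. cnj (W $$ (a, j)) * Y $$ (a, b)) * W $$ (b, j))"
    using rebase_index[OF W Y j j] by simp
  also have "\<dots> = (\<Sum>b<N. if b = j then (\<Sum>a<N. cnj (W $$ (a, j)) * Y $$ (a, j)) * W $$ (j, j) else 0)"
    using off j by (intro sum.cong) auto
  also have "\<dots> = (\<Sum>a<N. cnj (W $$ (a, j)) * Y $$ (a, j)) * W $$ (j, j)" using j by simp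
  also have "(\<Sum>a<N. cnj (W $$ (a, j)) * Y $$ (a, j)) = (\<Sum>a<N. if a = j then cnj (W $$ (j, j)) * Y $$ (j, j) else 0)"
    using off j by (intro sum.cong) auto
  also have "\<dots> = cnj (W $$ (j, j)) * Y $$ (j, j)" using j by simp
  also have "cnj (W $$ (j, j)) * Y $$ (j, j) * W $$ (j, j) = Y $$ (j, j)" using unimod by (metis mult.assoc mult.commute mult_1)
  finally show ?thesis by (simp add: Y_def)
qed

lemma rebase_translate_diag:
  assumes d: "d > 0" and U: "unitary (d ^ n) U" and A: "A \<in> carrier_mat (d ^ n) (d ^ n)"
    and H: "H = U * mat_diag (d ^ n) e * mat_adjoint U" and comm: "H * transl d n = transl d n * H"
    and inj: "inj_on e {..<d ^ n}" and j: "j < d ^ n"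
  shows "rebase U (translate d n k A) $$ (j, j) = rebase U A $$ (j, j)"
proof (induction k)
  case 0
  have "translate d n 0 A = A" using A by (intro eq_matI) (auto simp: translate_def)
  thus ?case by simp
next
  case (Suc k)
  show ?case
    unfolding translate_Suc[OF d]
      rebase_symmetry_diag[OF U unitary_transl[OF d] translate_carrier H comm inj j]
    by (rule Suc)
qed

lemma frob_sq_translate:
  assumes d: "d > 0" and A: "A \<in> carrier_mat (d ^ n) (d ^ n)"
  shows "frob_sq (translate d n k A) = frob_sq A"
proof -
  let ?p = "shift d n ^^ k"
  have "frob_sq (translate d n k A) = (\<Sum>i<d ^ n. \<Sum>j<d ^ n. (cmod (A $$ (?p i, ?p j)))\<^sup>2)"
    by (simp add: frob_sq_def translate_def)
  also have "\<dots> = (\<Sum>i<d ^ n. \<Sum>j<d ^ n. (cmod (A $$ (?p i, j)))\<^sup>2)"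
    by (intro sum.cong refl sum_shift_funpow[OF d])
  also have "\<dots> = (\<Sum>i<d ^ n. \<Sum>j<d ^ n. (cmod (A $$ (i, j)))\<^sup>2)"
    by (rule sum_shift_funpow[OF d, of "\<lambda>i. \<Sum>j<d ^ n. (cmod (A $$ (i, j)))\<^sup>2"])
  finally show ?thesis using A by (simp add: frob_sq_def)
qed

section \<open>The diagonal weight of a local operator\<close>

text \<open>Both squared norms share the bound \<open>F\<close>, so the entrywise inequality between
  geometric and arithmetic means can take the place of Cauchy-Schwarz.\<close>

lemma hs_inner_le_frob_sq:
  assumes "X \<in> carrier_mat N N" "Y \<in> carrier_mat N N" "frob_sq X \<le> F" "frob_sq Y \<le> F"
  shows "cmod (\<Sum>i<N. \<Sum>j<N. cnj (X $$ (i, j)) * Y $$ (i, j)) \<le> F"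
proof -
  have "cmod (\<Sum>i<N. \<Sum>j<N. cnj (X $$ (i, j)) * Y $$ (i, j))
      \<le> (\<Sum>i<N. \<Sum>j<N. cmod (X $$ (i, j)) * cmod (Y $$ (i, j)))"
    by (intro sum_norm_le) (simp add: norm_mult)
  also have "\<dots> \<le> (\<Sum>i<N. \<Sum>j<N. ((cmod (X $$ (i, j)))\<^sup>2 + (cmod (Y $$ (i, j)))\<^sup>2) / 2)"
  proof (intro sum_mono)
    fix i j
    show "cmod (X $$ (i, j)) * cmod (Y $$ (i, j)) \<le> ((cmod (X $$ (i, j)))\<^sup>2 + (cmod (Y $$ (i, j)))\<^sup>2) / 2"
      using sum_squares_bound[of "cmod (X $$ (i, j))" "cmod (Y $$ (i, j))"] by simp
  qed
  also have "\<dots> = (frob_sq X + frob_sq Y) / 2"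
    using assms(1,2) by (simp add: frob_sq_def sum.distrib sum_divide_distrib[symmetric])
  finally show ?thesis using assms(3,4) by simp
qed

text \<open>In the eigenbasis the sum \<open>Y\<close> of the \<open>n\<close> translates has
  \<open>n\<close> times the diagonal of \<open>A\<close>. Its squared Frobenius norm is a double
  sum over pairs of translates, in which only the at most \<open>n * r\<^sup>2\<close> overlapping
  pairs contribute, each at most \<open>d ^ n * M\<^sup>2\<close>. Division by the square of
  \<open>n\<close> leaves a factor \<open>1 / n\<close>.\<close>

lemma diagonal_weight_bound:
  assumes d: "d > 0" and U: "unitary (d ^ n) U"
    and H: "H = U * mat_diag (d ^ n) e * mat_adjoint U" and comm: "H * transl d n = transl d n * H"
    and inj: "inj_on e {..<d ^ n}"
    and loc: "r_local d n r A" and tr: "mtrace A = 0" and bd: "bounded_by (d ^ n) M A"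
  shows "(\<Sum>j<d ^ n. (cmod (rebase U A $$ (j, j)))\<^sup>2) \<le> real (d ^ n) * (real r)\<^sup>2 * M\<^sup>2 / real n"
\<comment> \<open>For \<open>n = 0\<close> the right-hand side is zero by the convention for
  division by zero, and the only diagonal entry is the trace, which vanishes.\<close>
proof (cases "n = 0")
  case True
  have A: "A \<in> carrier_mat (d ^ n) (d ^ n)" using bd by (simp add: bounded_by_def)
  have "mtrace (rebase U A) = 0" using mtrace_rebase[OF U A] tr by simp
  hence "rebase U A $$ (0, 0) = 0" using rebase_carrier[OF U A] True by (simp add: mtrace_def)
  thus ?thesis using True by simp
next
  case False
  hence n: "n > 0" by simp
  let ?N = "d ^ n"
  have A: "A \<in> carrier_mat ?N ?N" using bd by (simp add: bounded_by_def)
  obtain s m where m: "m \<le> r" and sup: "supported d n (cyc_interval n s m) A"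
    by (rule r_local_supported[OF loc n])
  define S where "S k = {x. x < n \<and> (x + k) mod n \<in> cyc_interval n s m}" for k
  define X where "X k = translate d n k A" for k
  define Y where "Y = mat ?N ?N (\<lambda>(i, j). \<Sum>k<n. X k $$ (i, j))"
  define bad where "bad = {(k, k'). k < n \<and> k' < n \<and> S k \<inter> S k' \<noteq> {}}"
  define hs where "hs = (\<lambda>(k, k'). \<Sum>i<?N. \<Sum>j<?N. cnj (X k $$ (i, j)) * X k' $$ (i, j))"
  have Xc: "X k \<in> carrier_mat ?N ?N" for k by (simp add: X_def)
  have Yc: "Y \<in> carrier_mat ?N ?N" by (simp add: Y_def)
  note Uc = unitary_carrier[OF U]
  have diagY: "rebase U Y $$ (j, j) = of_nat n * rebase U A $$ (j, j)" if j: "j < ?N" for j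
  proof -
    have "rebase U Y $$ (j, j) = (\<Sum>b<?N. (\<Sum>a<?N. cnj (U $$ (a, j)) * (\<Sum>k<n. X k $$ (a, b))) * U $$ (b, j))"
      unfolding rebase_index[OF Uc(1) Yc j j] by (simp add: Y_def)
    also have "\<dots> = (\<Sum>b<?N. \<Sum>a<?N. \<Sum>k<n. cnj (U $$ (a, j)) * X k $$ (a, b) * U $$ (b, j))"
      by (simp add: sum_distrib_left sum_distrib_right)
    also have "\<dots> = (\<Sum>b<?N. \<Sum>k<n. \<Sum>a<?N. cnj (U $$ (a, j)) * X k $$ (a, b) * U $$ (b, j))"
      by (intro sum.cong refl sum.swap)
    also have "\<dots> = (\<Sum>k<n. \<Sum>b<?N. \<Sum>a<?N. cnj (U $$ (a, j)) * X k $$ (a, b) * U $$ (b, j))"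
      by (rule sum.swap)
    also have "\<dots> = (\<Sum>k<n. rebase U (X k) $$ (j, j))"
      by (simp only: rebase_index[OF Uc(1) Xc j j] sum_distrib_right)
    also have "\<dots> = (\<Sum>k<n. rebase U A $$ (j, j))"
      unfolding X_def by (simp only: rebase_translate_diag[OF d U A H comm inj j])
    finally show ?thesis by simp
  qed
  have hs_bound: "cmod (hs p) \<le> real ?N * M\<^sup>2" for p
  proof -
    obtain k k' where p: "p = (k, k')" by (cases p)
    have "frob_sq (X l) \<le> real ?N * M\<^sup>2" for l
      unfolding X_def frob_sq_translate[OF d A] by (rule bounded_by_frob_sq[OF bd])
    from hs_inner_le_frob_sq[OF Xc Xc this this] show ?thesis unfolding hs_def p by simp
  qed
  have hs_zero: "hs p = 0" if good: "p \<in> {..<n} \<times> {..<n} - bad" for p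
  proof -
    obtain k k' where p: "p = (k, k')" "k < n" "k' < n" "S k \<inter> S k' = {}"
      using good by (cases p) (auto simp: bad_def)
    have sk: "supported d n (S l) (X l)" for l unfolding S_def X_def by (rule supported_translate[OF d sup])
    have "mtrace (X k') = 0" using mtrace_translate[OF d A] tr by (simp add: X_def)
    thus ?thesis using supported_disjoint_orthogonal[OF d sk sk p(4)] by (simp add: hs_def p(1))
  qed
  have bad_sub: "bad \<subseteq> {..<n} \<times> {..<n}" by (auto simp: bad_def)
  have card_bad: "card bad \<le> n * r\<^sup>2"
    unfolding bad_def S_def by (rule card_overlapping_translates[OF n m])
  \<comment> \<open>The squared modulus of a sum of translates is opened into a sum over pairs,
    which is then moved outside the sums over entries.\<close>
  have "complex_of_real (frob_sq Y) = (\<Sum>i<?N. \<Sum>j<?N. \<Sum>p\<in>{..<n} \<times> {..<n}. case p of (k, k') \<Rightarrow> cnj (X k $$ (i, j)) * X k' $$ (i, j))"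
  proof -
    have "complex_of_real (frob_sq Y) = (\<Sum>i<?N. \<Sum>j<?N. cnj (\<Sum>k<n. X k $$ (i, j)) * (\<Sum>k<n. X k $$ (i, j)))"
      by (simp add: frob_sq_def Y_def complex_norm_square mult.commute del: of_real_power cnj_sum)
    thus ?thesis by (simp add: sum_product sum.cartesian_product)
  qed
  also have "\<dots> = (\<Sum>i<?N. \<Sum>p\<in>{..<n} \<times> {..<n}. \<Sum>j<?N. case p of (k, k') \<Rightarrow> cnj (X k $$ (i, j)) * X k' $$ (i, j))"
    by (intro sum.cong refl sum.swap)
  also have "\<dots> = (\<Sum>p\<in>{..<n} \<times> {..<n}. \<Sum>i<?N. \<Sum>j<?N. case p of (k, k') \<Rightarrow> cnj (X k $$ (i, j)) * X k' $$ (i, j))"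
    by (rule sum.swap)
  also have "\<dots> = (\<Sum>p\<in>{..<n} \<times> {..<n}. hs p)"
    by (intro sum.cong refl) (auto simp: hs_def)
  also have "\<dots> = (\<Sum>p\<in>bad. hs p)"
    by (rule sum.mono_neutral_right) (use bad_sub hs_zero in auto)
  finally have frob: "complex_of_real (frob_sq Y) = (\<Sum>p\<in>bad. hs p)" .
  have "frob_sq Y \<ge> 0" unfolding frob_sq_def by (intro sum_nonneg) simp
  hence "frob_sq Y = cmod (\<Sum>p\<in>bad. hs p)" unfolding frob[symmetric] by simp
  also have "\<dots> \<le> (\<Sum>p\<in>bad. real ?N * M\<^sup>2)"
    by (intro sum_norm_le hs_bound)
  also have "\<dots> = real (card bad) * (real ?N * M\<^sup>2)" by simp
  also have "\<dots> \<le> real (n * r\<^sup>2) * (real ?N * M\<^sup>2)"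
    using card_bad by (intro mult_right_mono) (simp_all only: of_nat_le_iff, simp)
  finally have frobY: "frob_sq Y \<le> real (n * r\<^sup>2) * (real ?N * M\<^sup>2)" .
  \<comment> \<open>The diagonal of \<open>Y\<close> carries at most its full Frobenius weight,
    which does not depend on the basis.\<close>
  have "(real n)\<^sup>2 * (\<Sum>j<?N. (cmod (rebase U A $$ (j, j)))\<^sup>2) = (\<Sum>j<?N. (cmod (rebase U Y $$ (j, j)))\<^sup>2)"
    by (simp add: sum_distrib_left diagY norm_mult power_mult_distrib)
  also have "\<dots> \<le> (\<Sum>i<?N. \<Sum>j<?N. (cmod (rebase U Y $$ (i, j)))\<^sup>2)"
  proof (rule sum_mono)
    fix i assume "i \<in> {..<?N}"
    thus "(cmod (rebase U Y $$ (i, i)))\<^sup>2 \<le> (\<Sum>j<?N. (cmod (rebase U Y $$ (i, j)))\<^sup>2)"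
      by (intro member_le_sum) auto
  qed
  also have "\<dots> = frob_sq Y"
    using frob_sq_rebase[OF U Yc] rebase_carrier[OF U Yc] by (simp add: frob_sq_def)
  also note frobY
  finally show ?thesis using n by (simp add: field_simps power2_eq_square)
qed

section \<open>Bounding the resonant terms\<close>

text \<open>Replacing \<open>x j * x l\<close> by half the sum of the squares separates the two
  indices; the nonnegative weight is then summed along rows in one half and along columns in the
  other.\<close>

lemma schur_test:
  fixes x :: "nat \<Rightarrow> real"
  assumes w: "\<And>j l. j < N \<Longrightarrow> l < N \<Longrightarrow> w j l \<ge> 0"
    and row: "\<And>j. j < N \<Longrightarrow> (\<Sum>l<N. w j l) \<le> K" and col: "\<And>l. l < N \<Longrightarrow> (\<Sum>j<N. w j l) \<le> K"
  shows "(\<Sum>j<N. \<Sum>l<N. x j * x l * w j l) \<le> K * (\<Sum>j<N. (x j)\<^sup>2)"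
proof -
  have "(\<Sum>j<N. \<Sum>l<N. x j * x l * w j l) \<le> (\<Sum>j<N. \<Sum>l<N. (x j)\<^sup>2 * w j l / 2 + (x l)\<^sup>2 * w j l / 2)"
  proof (intro sum_mono)
    fix j l assume "j \<in> {..<N}" "l \<in> {..<N}"
    hence "2 * x j * x l * w j l \<le> ((x j)\<^sup>2 + (x l)\<^sup>2) * w j l"
      using w by (intro mult_right_mono sum_squares_bound) auto
    thus "x j * x l * w j l \<le> (x j)\<^sup>2 * w j l / 2 + (x l)\<^sup>2 * w j l / 2"
      by (simp add: algebra_simps)
  qed
  also have "\<dots> = (\<Sum>j<N. (x j)\<^sup>2 * (\<Sum>l<N. w j l)) / 2 + (\<Sum>l<N. (x l)\<^sup>2 * (\<Sum>j<N. w j l)) / 2"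
    by (simp add: sum.distrib sum_divide_distrib sum_distrib_left,
        subst sum.swap, simp)
  also have "\<dots> \<le> (\<Sum>j<N. (x j)\<^sup>2 * K) / 2 + (\<Sum>l<N. (x l)\<^sup>2 * K) / 2"
    using row col by (intro add_mono divide_right_mono sum_mono mult_left_mono) auto
  also have "\<dots> = K * (\<Sum>j<N. (x j)\<^sup>2)"
    by (simp add: sum_distrib_left mult.commute)
  finally show ?thesis .
qed

text \<open>The time-independent amplitude of one closed path j, k, l, m, j in the expanded trace,
  with the normalisation by the dimension included.\<close>

definition otoc_coeff :: "nat \<Rightarrow> complex mat \<Rightarrow> complex mat \<Rightarrow> nat \<times> nat \<times> nat \<times> nat \<Rightarrow> complex" where
  "otoc_coeff N A B = (\<lambda>(j, k, l, m).
     cnj (A $$ (k, j)) * cnj (B $$ (l, k)) * A $$ (l, m) * B $$ (m, j) / of_nat N)"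

text \<open>The conjugated factor of \<open>A\<close> oscillates with frequency
  \<open>E j - E k\<close> and the other with \<open>E l - E m\<close>, while \<open>B\<close> is
  constant. The total is written as a difference of two gaps, so that frequency zero means equality
  of gaps.\<close>

lemma otoc_eq_trig_sum:
  assumes U: "unitary N U" and A: "A \<in> carrier_mat N N" and B: "B \<in> carrier_mat N N"
    and H: "H = U * mat_diag N (\<lambda>j. complex_of_real (E j)) * mat_adjoint U"
  shows "otoc H A B t = (\<Sum>q\<in>{..<N} \<times> {..<N} \<times> {..<N} \<times> {..<N}.
     otoc_coeff N (rebase U A) (rebase U B) q *
     exp (\<i> * of_real (t * (case q of (j, k, l, m) \<Rightarrow> (E j - E k) - (E m - E l)))))"
proof -
  let ?A = "rebase U A" and ?B = "rebase U B"
  define Z where "Z = heis H t A"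
  have Z: "Z \<in> carrier_mat N N" unfolding Z_def by (rule heis_carrier[OF U A H])
  define X where "X = rebase U Z"
  have X: "X \<in> carrier_mat N N" unfolding X_def by (rule rebase_carrier[OF U Z])
  have Xi: "X $$ (j, k) = exp (\<i> * of_real (t * (E j - E k))) * ?A $$ (j, k)" if "j < N" "k < N" for j k
    unfolding X_def Z_def by (rule rebase_heis_index[OF U A H that])
  have Bc: "?B \<in> carrier_mat N N" by (rule rebase_carrier[OF U B])
  have dimH: "dim_row H = N" unfolding H using unitary_carrier[OF U] by simp
  note mc = mult_carrier_mat[where nr = N and n = N and nc = N]
  have "mtrace (mat_adjoint Z * mat_adjoint B * Z * B) = mtrace (rebase U (mat_adjoint Z * mat_adjoint B * Z * B))"
    using Z B by (intro mtrace_rebase[OF U, symmetric]) (simp add: mc)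
  also have "rebase U (mat_adjoint Z * mat_adjoint B * Z * B) = mat_adjoint X * mat_adjoint ?B * X * ?B"
    unfolding X_def using Z B by (simp add: rebase_mult[OF U] rebase_adjoint[OF U] mc)
  also have "mtrace \<dots> = (\<Sum>j<N. \<Sum>k<N. \<Sum>l<N. \<Sum>m<N.
      cnj (X $$ (k, j)) * cnj (?B $$ (l, k)) * X $$ (l, m) * ?B $$ (m, j))"
    by (rule mtrace_otoc_product[OF X Bc])
  finally have "otoc H A B t = (\<Sum>j<N. \<Sum>k<N. \<Sum>l<N. \<Sum>m<N.
      cnj (X $$ (k, j)) * cnj (?B $$ (l, k)) * X $$ (l, m) * ?B $$ (m, j) / of_nat N)"
    by (simp add: otoc_def Z_def[symmetric] dimH sum_divide_distrib)
  also have "\<dots> = (\<Sum>j<N. \<Sum>k<N. \<Sum>l<N. \<Sum>m<N. otoc_coeff N ?A ?B (j, k, l, m) *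
      exp (\<i> * of_real (t * ((E j - E k) - (E m - E l)))))"
  proof (intro sum.cong refl)
    fix j k l m assume "j \<in> {..<N}" "k \<in> {..<N}" "l \<in> {..<N}" "m \<in> {..<N}"
    hence i: "j < N" "k < N" "l < N" "m < N" by auto
    have ph: "exp (\<i> * of_real (t * (E j - E k))) * exp (\<i> * of_real (t * (E l - E m)))
        = exp (\<i> * complex_of_real (t * ((E j - E k) - (E m - E l))))"
      unfolding exp_add[symmetric] by (simp add: algebra_simps)
    have "cnj (exp (\<i> * complex_of_real (t * (E k - E j)))) = exp (\<i> * of_real (t * (E j - E k)))"
      unfolding exp_cnj by (simp add: algebra_simps)
    thus "cnj (X $$ (k, j)) * cnj (?B $$ (l, k)) * X $$ (l, m) * ?B $$ (m, j) / of_nat N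
        = otoc_coeff N ?A ?B (j, k, l, m) * exp (\<i> * of_real (t * ((E j - E k) - (E m - E l))))"
      unfolding Xi[OF i(2,1)] Xi[OF i(3,4)] otoc_coeff_def complex_cnj_mult ph[symmetric]
      by (simp only: prod.case) (simp only: times_divide_eq_left times_divide_eq_right mult_ac)
  qed
  finally show ?thesis by (simp add: sum.cartesian_product case_prod_beta)
qed

text \<open>Equal gaps leave the index families (j, j, l, l) and (j, k, k, j). In the first,
  diagonal entries of \<open>A\<close> at \<open>j\<close> and \<open>l\<close> are weighted by
  squared moduli of entries of \<open>B\<close>; the second has the roles exchanged. The Schur test
  applies to each, as rows and columns have squared length at most \<open>M\<^sup>2\<close>.\<close>

lemma resonant_otoc_sum_bound:
  fixes E :: "nat \<Rightarrow> real"
  assumes U: "unitary N U" and bA: "bounded_by N M A" and bB: "bounded_by N M B"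
    and gaps: "\<And>j k l m. \<lbrakk>j < N; k < N; l < N; m < N; j \<noteq> k; E j - E k = E l - E m\<rbrakk> \<Longrightarrow> j = l \<and> k = m"
    and dA: "(\<Sum>j<N. (cmod (rebase U A $$ (j, j)))\<^sup>2) \<le> K"
    and dB: "(\<Sum>j<N. (cmod (rebase U B $$ (j, j)))\<^sup>2) \<le> K"
  shows "cmod (\<Sum>q\<in>{..<N} \<times> {..<N} \<times> {..<N} \<times> {..<N}.
      if (case q of (j, k, l, m) \<Rightarrow> (E j - E k) - (E m - E l)) = 0
      then otoc_coeff N (rebase U A) (rebase U B) q else 0) \<le> 2 * M\<^sup>2 * K / real N"
proof -
  let ?A = "rebase U A" and ?B = "rebase U B"
  let ?Q = "{..<N} \<times> {..<N} \<times> {..<N} \<times> {..<N}"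
  let ?w = "\<lambda>(j, k, l, m). (E j - E k) - (E m - E l)"
  let ?c = "otoc_coeff N ?A ?B"
  let ?f = "\<lambda>(j, l). (j, j, l, l)" and ?g = "\<lambda>(j, k). (j, k, k, j)"
  let ?P = "{..<N} \<times> {..<N}"
  have dist: "E j \<noteq> E k" if "j < N" "k < N" "j \<noteq> k" for j k
    using gaps[OF that(1,2) that(1,1) that(3)] that(3) by auto
  have res: "{q \<in> ?Q. ?w q = 0} \<subseteq> ?f ` ?P \<union> ?g ` ?P"
  proof
    fix q assume "q \<in> {q \<in> ?Q. ?w q = 0}"
    then obtain j k l m where q: "q = (j, k, l, m)" and i: "j < N" "k < N" "l < N" "m < N"
      and "(E j - E k) - (E m - E l) = 0" by (cases q) auto
    from this(6) have eq: "E j - E k = E m - E l" by linarith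
    show "q \<in> ?f ` ?P \<union> ?g ` ?P"
    proof (cases "j = k")
      case True
      \<comment> \<open>The gap on the left is zero, and distinct levels never have gap
        zero.\<close>
      hence "l = m" using eq dist[OF i(3,4)] by auto
      thus ?thesis using True i q by (intro UnI1 image_eqI[of _ _ "(j, l)"]) auto
    next
      case False
      hence "j = m \<and> k = l" by (rule gaps[OF i(1,2,4,3) _ eq])
      thus ?thesis using i q by (intro UnI2 image_eqI[of _ _ "(j, k)"]) auto
    qed
  qed
  have "cmod (\<Sum>q\<in>?Q. if ?w q = 0 then ?c q else 0) = cmod (\<Sum>q\<in>{q \<in> ?Q. ?w q = 0}. ?c q)"
    by (subst sum.inter_filter) simp_all
  also have "\<dots> \<le> (\<Sum>q\<in>{q \<in> ?Q. ?w q = 0}. cmod (?c q))" by (rule norm_sum)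
  also have "\<dots> \<le> (\<Sum>q\<in>?f ` ?P \<union> ?g ` ?P. cmod (?c q))"
    by (rule sum_mono2[OF _ res]) auto
  \<comment> \<open>The families meet where all four indices coincide; counting these terms twice
    only enlarges the bound.\<close>
  also have "\<dots> \<le> (\<Sum>q\<in>?f ` ?P. cmod (?c q)) + (\<Sum>q\<in>?g ` ?P. cmod (?c q))"
    by (subst sum.union_inter[symmetric]) (simp_all add: sum_nonneg)
  also have "(\<Sum>q\<in>?f ` ?P. cmod (?c q)) = (\<Sum>p\<in>?P. cmod (?c (?f p)))"
    by (rule sum.reindex_cong[OF _ refl refl]) (auto intro: inj_onI)
  also have "\<dots> = (\<Sum>j<N. \<Sum>l<N. cmod (?A $$ (j, j)) * cmod (?A $$ (l, l)) * (cmod (?B $$ (l, j)))\<^sup>2) / real N"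
    by (simp add: sum.cartesian_product sum_divide_distrib otoc_coeff_def norm_divide norm_mult
        power2_eq_square mult_ac case_prod_beta)
  also have "(\<Sum>q\<in>?g ` ?P. cmod (?c q)) = (\<Sum>p\<in>?P. cmod (?c (?g p)))"
    by (rule sum.reindex_cong[OF _ refl refl]) (auto intro: inj_onI)
  also have "\<dots> = (\<Sum>j<N. \<Sum>k<N. cmod (?B $$ (j, j)) * cmod (?B $$ (k, k)) * (cmod (?A $$ (k, j)))\<^sup>2) / real N"
    by (simp add: sum.cartesian_product sum_divide_distrib otoc_coeff_def norm_divide norm_mult
        power2_eq_square mult_ac case_prod_beta)
  also have "(\<Sum>j<N. \<Sum>l<N. cmod (?A $$ (j, j)) * cmod (?A $$ (l, l)) * (cmod (?B $$ (l, j)))\<^sup>2) / real N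
      + (\<Sum>j<N. \<Sum>k<N. cmod (?B $$ (j, j)) * cmod (?B $$ (k, k)) * (cmod (?A $$ (k, j)))\<^sup>2) / real N
      \<le> M\<^sup>2 * K / real N + M\<^sup>2 * K / real N"
  proof -
    have test: "(\<Sum>j<N. \<Sum>l<N. cmod (X $$ (j, j)) * cmod (X $$ (l, l)) * (cmod (rebase U Y $$ (l, j)))\<^sup>2) \<le> M\<^sup>2 * K"
      if Y: "bounded_by N M Y" and X: "(\<Sum>j<N. (cmod (X $$ (j, j)))\<^sup>2) \<le> K" for X Y
    proof -
      have "(\<Sum>j<N. \<Sum>l<N. cmod (X $$ (j, j)) * cmod (X $$ (l, l)) * (cmod (rebase U Y $$ (l, j)))\<^sup>2)
          \<le> M\<^sup>2 * (\<Sum>j<N. (cmod (X $$ (j, j)))\<^sup>2)"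
        by (rule schur_test) (use bounded_by_rebase_col[OF Y U] bounded_by_rebase_row[OF Y U] in auto)
      also have "\<dots> \<le> M\<^sup>2 * K" using X by (simp add: mult_left_mono)
      finally show ?thesis .
    qed
    show ?thesis
      by (rule add_mono[OF divide_right_mono[OF test[OF bB dA]] divide_right_mono[OF test[OF bA dB]]]) simp_all
  qed
  also have "\<dots> = 2 * M\<^sup>2 * K / real N" by simp
  finally show ?thesis .
qed

theorem theorem2:
  fixes d r :: nat and M :: real
  assumes "d \<ge> 2" and "r \<ge> 1" and "M > 0"
  shows "\<exists>C>0. \<forall>(n::nat) H A B.
     H \<in> carrier_mat (d ^ n) (d ^ n) \<and> mat_adjoint H = H \<and>
     H * transl d n = transl d n * H \<and> nondeg_gaps H \<and>
     r_local d n r A \<and> r_local d n r B \<and> mtrace A = 0 \<and> mtrace B = 0 \<and>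
     opnorm A \<le> M \<and> opnorm B \<le> M \<longrightarrow>
     (\<exists>L. ((\<lambda>\<tau>. integral {0..\<tau>} (otoc H A B) / complex_of_real \<tau>) \<longlongrightarrow> L) at_top \<and>
          cmod L \<le> C / real n)"
proof (intro exI[of _ "2 * (real r)\<^sup>2 * M ^ 4"] conjI allI impI, goal_cases)
  case 1
  show ?case using assms by simp
next
  case (2 n H A B)
  let ?N = "d ^ n"
  have d: "d > 0" using assms(1) by simp
  have A: "A \<in> carrier_mat ?N ?N" and B: "B \<in> carrier_mat ?N ?N"
    using 2 by (simp_all add: r_local_def)
  have bA: "bounded_by ?N M A" and bB: "bounded_by ?N M B"
    using bounded_by_mono[OF bounded_by_opnorm] A B 2 by blast+
  obtain U and E :: "nat \<Rightarrow> real" where U: "unitary ?N U"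
    and H: "H = U * mat_diag ?N (\<lambda>j. complex_of_real (E j)) * mat_adjoint U"
    and gaps: "\<And>j k l m. \<lbrakk>j < ?N; k < ?N; l < ?N; m < ?N; j \<noteq> k; E j - E k = E l - E m\<rbrakk> \<Longrightarrow> j = l \<and> k = m"
    using spectral_theorem_nondeg[of H ?N] 2 by metis
  \<comment> \<open>Two equal levels would repeat the trivial gap of \<open>j\<close> with
    itself.\<close>
  have "j = k" if "j < ?N" "k < ?N" "E j = E k" for j k
    using gaps[OF that(1,2) that(1,1)] that(3) by auto
  hence inj: "inj_on (\<lambda>j. complex_of_real (E j)) {..<?N}" by (auto intro: inj_onI)
  have comm: "H * transl d n = transl d n * H" using 2 by simp
  note weight = diagonal_weight_bound[OF d U H comm inj]
  let ?Q = "{..<?N} \<times> {..<?N} \<times> {..<?N} \<times> {..<?N}"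
  let ?w = "\<lambda>q. case q of (j, k, l, m) \<Rightarrow> (E j - E k) - (E m - E l)"
  let ?L = "\<Sum>q\<in>?Q. if ?w q = 0 then otoc_coeff ?N (rebase U A) (rebase U B) q else 0"
  have "((\<lambda>\<tau>. integral {0..\<tau>} (otoc H A B) / complex_of_real \<tau>) \<longlongrightarrow> ?L) at_top"
    unfolding otoc_eq_trig_sum[OF U A B H, abs_def] by (rule time_average_trig_sum) simp
  moreover have "cmod ?L \<le> 2 * M\<^sup>2 * (real ?N * (real r)\<^sup>2 * M\<^sup>2 / real n) / real ?N"
  proof (rule resonant_otoc_sum_bound[OF U bA bB])
    show "j = l \<and> k = m"
      if "j < ?N" "k < ?N" "l < ?N" "m < ?N" "j \<noteq> k" "E j - E k = E l - E m" for j k l m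
      using that by (rule gaps)
    show "(\<Sum>j<?N. (cmod (rebase U A $$ (j, j)))\<^sup>2) \<le> real ?N * (real r)\<^sup>2 * M\<^sup>2 / real n"
      by (rule weight[OF _ _ bA]) (use 2 in simp_all)
    show "(\<Sum>j<?N. (cmod (rebase U B $$ (j, j)))\<^sup>2) \<le> real ?N * (real r)\<^sup>2 * M\<^sup>2 / real n"
      by (rule weight[OF _ _ bB]) (use 2 in simp_all)
  qed
  \<comment> \<open>The 2 counts the resonant families, one \<open>M\<^sup>2\<close> comes from the
    Schur test, and \<open>r\<^sup>2\<close> with the other \<open>M\<^sup>2\<close> from the
    diagonal weight. The dimension in that weight cancels against the normalisation of the
    trace.\<close>
  moreover have "2 * M\<^sup>2 * (real ?N * (real r)\<^sup>2 * M\<^sup>2 / real n) / real ?N = 2 * (real r)\<^sup>2 * M ^ 4 / real n"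
  proof -
    have "M ^ 4 = M\<^sup>2 * M\<^sup>2" by (simp add: power_add[symmetric])
    thus ?thesis using d by simp
  qed
  ultimately show ?case by (intro exI[of _ ?L] conjI) (simp_all only:)
qed

end
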